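(* There exist absolute constants $A, B > 0$ and $t \in \mathbb{N}$ such that the following holds. Let $2 \leq k \leq 5$ and $2 \leq m \leq k$ be integers, let $r$ be a positive integer, and let $G = \mathbb{F}_2^n$ for some $n$. Let $\alpha \colon G^k \to \mathbb{F}_2$ be a multilinear form which is symmetric in the first $m$ variables. Suppose also that the multilinear form $(d, a_3, \dots, a_k) \mapsto \alpha(d,d,a_3,\dots,a_k)$ on $G^{k-1}$ has partition rank at most $r$. Then there exist a subspace $U \leq G$ of codimension at most $\exp^{(t)}(Ar)$ and a multilinear form $\alpha' \colon U^k \to \mathbb{F}_2$, also symmetric in the first $m$ variables, such that $\alpha'(d,d,a_3,\dots,a_k) = 0$ for all $d, a_3, \dots, a_k \in U$ and $\operatorname{prank}(\alpha|_{U \times \cdots \times U} + \alpha') \leq \exp(\exp(A r^{B}))$.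
   Context: A form is symmetric in a set of variables if it is invariant under all permutations of those variables. $\exp^{(t)}$ denotes the $t$-fold composition of the exponential function. For a finite-dimensional $\mathbb{F}_2$-vector space $V$, the partition rank $\operatorname{prank}\alpha$ of a multilinear form $\alpha \colon V^k \to \mathbb{F}_2$ is the least non-negative integer $m$ such that \[\alpha(x_1,\dots,x_k) = \sum_{i=1}^m \beta_i(x_j : j \in I_i)\,\gamma_i(x_j : j \in [k]\setminus I_i)\] for some sets $\emptyset \neq I_i \subsetneq [k]$ and multilinear forms $\beta_i \colon V^{I_i} \to \mathbb{F}_2$, $\gamma_i \colon V^{[k]\setminus I_i} \to \mathbb{F}_2$. (For $k=1$, with no admissible sets $I_i$, the zero form has partition rank $0$ and a non-zero linear form has partition rank $\infty$.) *)

theory Defs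
  imports
    Complex_Main
    "HOL-Library.Z2"
    "HOL-Library.FuncSet"
    "HOL-Library.Function_Algebras"
    "HOL-Library.Extended_Real"
    "HOL-Combinatorics.Permutations"
begin

text \<open>
  The dimension is quantified inside the statement, so F_2^n cannot be a type. All vectors live in
  the F_2-vector space of sequences, and F_2^n is the subspace of sequences supported on
  \<open>{..<n}\<close>.
\<close>

type_synonym f2vec = "nat \<Rightarrow> bit"

definition f2_scale :: "bit \<Rightarrow> f2vec \<Rightarrow> f2vec" where
  "f2_scale c v = (\<lambda>i. c * v i)"

global_interpretation f2: vector_space f2_scale
  defines f2_subspace = f2.subspace
    and f2_span = f2.span
    and f2_dependent = f2.dependent
    and f2_dim = f2.dim
  by unfold_locales (auto simp: f2_scale_def fun_eq_iff algebra_simps)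

definition f2_power :: "nat \<Rightarrow> f2vec set" where
  "f2_power n = {v. \<forall>i\<ge>n. v i = 0}"

text \<open>
  An element of \<open>V^I\<close> is an extensional function in \<open>I \<rightarrow>\<^sub>E V\<close>. A form on \<open>V^I\<close> is given by a
  function on all families of vectors, of which only the values on \<open>I \<rightarrow>\<^sub>E V\<close> matter; in
  particular the restriction of a form to a subspace is given by the same function.
\<close>

type_synonym form = "(nat \<Rightarrow> f2vec) \<Rightarrow> bit"

definition multilinear_form :: "f2vec set \<Rightarrow> nat set \<Rightarrow> form \<Rightarrow> bool" where
  "multilinear_form V I \<alpha> \<longleftrightarrow>
    (\<forall>x \<in> I \<rightarrow>\<^sub>E V. \<forall>j\<in>I.
      (\<forall>u\<in>V. \<forall>v\<in>V. \<alpha> (x(j := u + v)) = \<alpha> (x(j := u)) + \<alpha> (x(j := v))) \<and>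
      (\<forall>c. \<forall>u\<in>V. \<alpha> (x(j := f2_scale c u)) = c * \<alpha> (x(j := u))))"

text \<open>Symmetry in the variables with index in \<open>J \<subseteq> I\<close>.\<close>

definition symmetric_in :: "f2vec set \<Rightarrow> nat set \<Rightarrow> nat set \<Rightarrow> form \<Rightarrow> bool" where
  "symmetric_in V I J \<alpha> \<longleftrightarrow> (\<forall>\<pi>. \<pi> permutes J \<longrightarrow> (\<forall>x \<in> I \<rightarrow>\<^sub>E V. \<alpha> (x \<circ> \<pi>) = \<alpha> x))"

definition has_partition_decomposition :: "f2vec set \<Rightarrow> nat set \<Rightarrow> form \<Rightarrow> nat \<Rightarrow> bool" where
  "has_partition_decomposition V I \<alpha> m \<longleftrightarrow>
    (\<exists>(S :: nat \<Rightarrow> nat set) (\<beta> :: nat \<Rightarrow> form) (\<gamma> :: nat \<Rightarrow> form).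
      (\<forall>i<m. S i \<noteq> {} \<and> S i \<subset> I \<and>
        multilinear_form V (S i) (\<beta> i) \<and> multilinear_form V (I - S i) (\<gamma> i)) \<and>
      (\<forall>x \<in> I \<rightarrow>\<^sub>E V.
        \<alpha> x = (\<Sum>i<m. \<beta> i (restrict x (S i)) * \<gamma> i (restrict x (I - S i)))))"

text \<open>The infimum of the empty set is \<open>\<infinity>\<close>.\<close>

definition prank :: "f2vec set \<Rightarrow> nat set \<Rightarrow> form \<Rightarrow> enat" where
  "prank V I \<alpha> = Inf (enat ` {m. has_partition_decomposition V I \<alpha> m})"

text \<open>
  The form \<open>(d, a\<^sub>3, \<dots>, a\<^sub>k) \<mapsto> \<alpha>(d, d, a\<^sub>3, \<dots>, a\<^sub>k)\<close>, with its \<open>k - 1\<close> variables indexed by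
  \<open>{1..k - 1}\<close>: \<open>d\<close> is variable 1 and \<open>a\<^sub>i\<close> is variable \<open>i - 1\<close>.
\<close>

definition diag12 :: "nat \<Rightarrow> form \<Rightarrow> form" where
  "diag12 k \<alpha> = (\<lambda>y. \<alpha> (\<lambda>i\<in>{1..k}. if i = 1 then y 1 else y (i - 1)))"

text \<open>Codimension of \<open>U\<close> in a finite-dimensional space \<open>V\<close>, where \<open>U \<subseteq> V\<close>.\<close>

definition f2_codim :: "f2vec set \<Rightarrow> f2vec set \<Rightarrow> nat" where
  "f2_codim V U = f2_dim V - f2_dim U"

end

theory Submission
  imports Defs
begin

text \<open>
  If \<open>k \<le> 4\<close>, every term of a partition decomposition of the diagonal has a factor in a single
  variable, so the diagonal vanishes on the common kernel of these factors and \<open>\<alpha>' = \<alpha>\<close> works there.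

  Let \<open>k = 5\<close> and let \<open>D\<close> be the diagonal. Fix a basis of \<open>U\<close> and write \<open>u \<circ> v\<close> for the
  coordinatewise product, which is bilinear with \<open>u \<circ> u = u\<close>. Let \<open>\<phi>\<close> be the sum over pairs \<open>p < q \<le> m\<close>
  of \<open>D(x\<^sub>p \<circ> x\<^sub>q, \<dots>)\<close>, the dots being the other variables. It is multilinear and symmetric, of partition
  rank at most \<open>10r\<close>. If \<open>x\<^sub>1 = x\<^sub>2 = d\<close>, then the pair \<open>{1, 2}\<close> contributes \<open>D\<close>, the pairs meeting
  \<open>{1, 2}\<close> in one element cancel, and the others contribute \<open>\<alpha>(d, d, z, z, c)\<close> with
  \<open>z = x\<^sub>p \<circ> x\<^sub>q\<close>. So \<open>\<alpha>' = \<alpha> + \<phi>\<close> works on any \<open>U\<close> on which \<open>T(d, z, c) = \<alpha>(d, d, z, z, c)\<close> vanishes.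

  The form \<open>T\<close> is trilinear and symmetric in \<open>d, z\<close>. After removing single-variable factors, the
  decomposition of \<open>D\<close> partitions the space into \<open>2\<^sup>r\<close> classes such that \<open>T(\<cdot>, z + z', \<cdot>)\<close> has rank at
  most \<open>2r\<close> for \<open>z, z'\<close> in one class. Choose greedily triples with \<open>T(d\<^sub>i, z\<^sub>i, c\<^sub>i) = 1\<close> and \<open>d\<^sub>i, z\<^sub>i\<close> of low
  rank, each in the kernels of the bilinear forms determined by its predecessors. By pigeonhole, a sum of at
  least \<open>2r + 1\<close> consecutive \<open>z\<^sub>i\<close> has low rank if there are many triples, but the triples exhibit a
  triangular matrix of larger rank. So the process stops after boundedly many steps, and then \<open>T\<close>
  vanishes on the span of the low-rank elements left, which has small codimension.
\<close>

section \<open>Finite subspaces\<close>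

lemma f2vec_add_self [simp]: "(x::f2vec) + x = 0"
  by (simp add: fun_eq_iff)

lemma f2vec_add_cancel [simp]: "(x::f2vec) + (x + y) = y"
  by (simp add: add.assoc [symmetric])

lemma f2_scale_bit: "f2_scale c x = (if c = 0 then 0 else x)"
  by (auto simp: f2_scale_def fun_eq_iff)

lemma bit_add_eq_0_iff: "(a::bit) + b = 0 \<longleftrightarrow> a = b"
  by (cases a; cases b) auto

lemma UNIV_bit: "(UNIV :: bit set) = {0, 1}"
  using bit_not_zero_iff by blast

lemma bit_eq_of_eq_1_iff: "((a::bit) = 1 \<longleftrightarrow> b = 1) \<Longrightarrow> a = b"
  by (cases a; cases b) auto

lemma f2_subspace_iff:
  "f2_subspace U \<longleftrightarrow> 0 \<in> U \<and> (\<forall>x\<in>U. \<forall>y\<in>U. x + y \<in> U)"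
  by (auto simp: f2.subspace_def f2_scale_bit)

lemma f2_subspace_f2_power: "f2_subspace (f2_power n)"
  by (auto simp: f2_subspace_iff f2_power_def)

lemma finite_f2_power: "finite (f2_power n)"
proof -
  have "inj_on (\<lambda>v. {i. v i = 1}) (f2_power n)"
  proof (rule inj_onI)
    fix v w :: f2vec
    assume "{i. v i = (1::bit)} = {i. w i = 1}"
    then have "v i = 1 \<longleftrightarrow> w i = 1" for i
      by blast
    then show "v = w"
      by (metis bit_not_zero_iff ext)
  qed
  moreover have "(\<lambda>v. {i. v i = 1}) ` f2_power n \<subseteq> Pow {..<n}"
    by (auto simp: f2_power_def) (metis linorder_not_le zero_neq_one)
  ultimately show ?thesis
    using finite_imageD finite_subset by (metis finite_Pow_iff finite_lessThan)
qed

text \<open>Translating a non-empty fibre of \<open>\<phi>\<close> by one of its points embeds it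
  into \<open>W\<close>. So labels of any type can bound the index of a subspace.\<close>

lemma card_le_index_mult:
  fixes \<phi> :: "f2vec \<Rightarrow> 'b"
  assumes "finite U" "finite W" "finite P" "\<phi> ` U \<subseteq> P"
    and "\<And>x y. x \<in> U \<Longrightarrow> y \<in> U \<Longrightarrow> \<phi> x = \<phi> y \<Longrightarrow> x + y \<in> W"
  shows "card U \<le> card P * card W"
proof -
  have "(\<Union>p\<in>P. {x\<in>U. \<phi> x = p}) = U"
    using assms(4) by auto
  then have "card U \<le> (\<Sum>p\<in>P. card {x\<in>U. \<phi> x = p})"
    using card_UN_le [OF assms(3), of "\<lambda>p. {x\<in>U. \<phi> x = p}"] by simp
  also have "\<dots> \<le> (\<Sum>p\<in>P. card W)"
  proof (rule sum_mono)
    fix p assume "p \<in> P"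
    show "card {x\<in>U. \<phi> x = p} \<le> card W"
    proof (cases "{x\<in>U. \<phi> x = p} = {}")
      case False
      then obtain x0 where x0: "x0 \<in> U" "\<phi> x0 = p" by blast
      have "inj_on ((+) x0) {x\<in>U. \<phi> x = p}"
        by simp
      moreover have "(+) x0 ` {x\<in>U. \<phi> x = p} \<subseteq> W"
        using x0 assms(5) by auto
      ultimately show ?thesis
        using assms(2) card_inj_on_le by blast
    qed (metis card.empty le0)
  qed
  finally show ?thesis by simp
qed

lemma card_image_factor:
  assumes "finite A" "\<And>x y. x \<in> A \<Longrightarrow> y \<in> A \<Longrightarrow> \<phi> x = \<phi> y \<Longrightarrow> g x = g y"
  shows "card (g ` A) \<le> card (\<phi> ` A)"
proof -
  have "g x = g (inv_into A \<phi> (\<phi> x))" if "x \<in> A" for x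
    using that assms(2) by (metis f_inv_into_f image_eqI inv_into_into)
  then have "g ` A = (\<lambda>p. g (inv_into A \<phi> p)) ` \<phi> ` A"
    by (auto simp: image_image)
  then show ?thesis
    using assms(1) by (metis card_image_le finite_imageI)
qed

lemma f2_span_eq_subset_sums:
  assumes "finite B"
  shows "f2_span B \<subseteq> (\<lambda>A. \<Sum>b\<in>A. b) ` Pow B"
proof
  fix x assume "x \<in> f2_span B"
  then obtain u where "x = (\<Sum>b\<in>B. f2_scale (u b) b)"
    using f2.span_finite [OF assms] by auto
  also have "\<dots> = (\<Sum>b | b \<in> B \<and> u b \<noteq> 0. b)"
    using assms by (intro sum.mono_neutral_cong_right) (auto simp: f2_scale_bit)
  finally show "x \<in> (\<lambda>A. \<Sum>b\<in>A. b) ` Pow B"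
    by auto
qed

text \<open>The subset sums of a basis list the vectors of \<open>U\<close> without repetition.
  Codimensions can therefore be tracked as ratios of cardinalities.\<close>

lemma card_f2_subspace:
  assumes "f2_subspace U" "finite U"
  shows "card U = 2 ^ f2_dim U"
proof -
  obtain B where B: "B \<subseteq> U" "\<not> f2_dependent B" "U \<subseteq> f2_span B" "card B = f2_dim U"
    using f2.basis_exists by blast
  have fin: "finite B"
    using B(1) assms(2) finite_subset by blast
  have le: "card U \<le> 2 ^ card B"
  proof -
    have "card U \<le> card ((\<lambda>A. \<Sum>b\<in>A. b) ` Pow B)"
      using f2_span_eq_subset_sums [OF fin] B(3) fin by (intro card_mono) auto
    also have "\<dots> \<le> card (Pow B)"
      using fin by (intro card_image_le) auto
    finally show ?thesis
      using fin by (simp add: card_Pow)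
  qed
  have "inj_on (\<lambda>A. \<Sum>b\<in>A. b) (Pow B)"
  proof (rule inj_onI, rule ccontr)
    fix A A' assume A: "A \<in> Pow B" "A' \<in> Pow B" "\<Sum>A = \<Sum>A'" "A \<noteq> A'"
    \<comment> \<open>Extending both sums to all of \<open>B\<close> with 0/1 coefficients turns a
      coincidence of subset sums into a linear relation on the basis.\<close>
    have split: "\<Sum>C = (\<Sum>b\<in>B. f2_scale (of_bool (b \<in> C)) b)" if "C \<in> Pow B" for C
      using that fin by (intro sum.mono_neutral_cong_left) (auto simp: f2_scale_bit)
    have "(\<Sum>b\<in>B. f2_scale (of_bool (b \<in> A) + of_bool (b \<in> A')) b) = \<Sum>A + \<Sum>A'"
      by (simp only: f2.scale_left_distrib sum.distrib split [OF A(1)] split [OF A(2)])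
    then have "(\<Sum>b\<in>B. f2_scale (of_bool (b \<in> A) + of_bool (b \<in> A')) b) = 0"
      using A(3) by (simp only: f2vec_add_self)
    then have "(of_bool (b \<in> A) + of_bool (b \<in> A') :: bit) = 0" if "b \<in> B" for b
      using that f2.independentD [OF B(2) fin order_refl,
          of "\<lambda>b. of_bool (b \<in> A) + of_bool (b \<in> A')"] by blast
    then have "b \<in> A \<longleftrightarrow> b \<in> A'" if "b \<in> B" for b
      using that by (metis bit_add_eq_0_iff of_bool_eq_iff)
    then show False
      using A by blast
  qed
  moreover have "(\<lambda>A. \<Sum>b\<in>A. b) ` Pow B \<subseteq> U"
    using B(1) assms(1) by (auto intro!: f2.subspace_sum)
  ultimately have "2 ^ card B \<le> card U"
    using assms(2) fin by (metis card_Pow card_inj_on_le)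
  with le B(4) show ?thesis
    by simp
qed

lemma f2_codim_le_of_card:
  assumes "f2_subspace V" "f2_subspace U" "finite V" "U \<subseteq> V" "card V \<le> 2 ^ s * card U"
  shows "f2_codim V U \<le> s"
proof -
  have "(2::nat) ^ f2_dim V \<le> 2 ^ (s + f2_dim U)"
    using assms card_f2_subspace finite_subset by (metis power_add)
  then have "f2_dim V \<le> s + f2_dim U"
    by simp
  then show ?thesis
    by (simp add: f2_codim_def)
qed

section \<open>Trilinear forms with low-rank slices\<close>

text \<open>The matrix \<open>g i (c j)\<close> is triangular with ones on the diagonal, so its rows
  are independent. At the largest index \<open>j\<close> of the symmetric difference, the terms
  beyond \<open>j\<close> agree, those before \<open>j\<close> are zero, and exactly one side
  contains the diagonal 1.\<close>

lemma sum_eq_imp_set_eq: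
  fixes g :: "nat \<Rightarrow> f2vec \<Rightarrow> bit"
  assumes "finite A" "finite B" "A \<subseteq> I" "B \<subseteq> I"
    and tri: "\<And>i j. i \<in> I \<Longrightarrow> j \<in> I \<Longrightarrow> i < j \<Longrightarrow> g i (c j) = 0"
    and diag: "\<And>i. i \<in> I \<Longrightarrow> g i (c i) = 1"
    and eq: "\<And>j. j \<in> I \<Longrightarrow> (\<Sum>i\<in>A. g i (c j)) = (\<Sum>i\<in>B. g i (c j))"
  shows "A = B"
proof (rule ccontr)
  assume "A \<noteq> B"
  define S where "S = (A - B) \<union> (B - A)"
  define j where "j = Max S"
  have S: "finite S" "S \<noteq> {}"
    using assms \<open>A \<noteq> B\<close> by (auto simp: S_def)
  then have j: "j \<in> S" and max: "\<And>i. i \<in> S \<Longrightarrow> i \<le> j"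
    by (auto simp: j_def)
  then have jI: "j \<in> I"
    using assms by (auto simp: S_def)
  have split: "(\<Sum>i\<in>C. g i (c j)) = of_bool (j \<in> C) + (\<Sum>i\<in>C \<inter> {j<..}. g i (c j))"
    if "finite C" "C \<subseteq> I" for C
  proof -
    have "(\<Sum>i\<in>C. g i (c j)) = (\<Sum>i\<in>C \<inter> {j..}. g i (c j))"
      using that tri jI by (intro sum.mono_neutral_right) (auto simp: not_le subset_iff)
    also have "\<dots> = of_bool (j \<in> C) + (\<Sum>i\<in>C \<inter> {j<..}. g i (c j))"
    proof (cases "j \<in> C")
      case True
      then have "C \<inter> {j..} = insert j (C \<inter> {j<..})"
        by auto
      then show ?thesis
        using True that diag jI by simp
    next
      case False
      then have "C \<inter> {j..} = C \<inter> {j<..}"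
        by (auto simp: le_less)
      then show ?thesis
        using False by simp
    qed
    finally show ?thesis .
  qed
  have "A \<inter> {j<..} = B \<inter> {j<..}"
    using max by (force simp: S_def)
  then have "(of_bool (j \<in> A) :: bit) = of_bool (j \<in> B)"
    using split [OF assms(1,3)] split [OF assms(2,4)] eq [OF jI] by (metis add_right_cancel)
  then show False
    using j by (auto simp: S_def)
qed

section \<open>Chains of triples and the vanishing of a symmetric trilinear form\<close>

locale sym_trilinear =
  fixes V :: "f2vec set" and T :: "f2vec \<Rightarrow> f2vec \<Rightarrow> f2vec \<Rightarrow> bit"
  assumes V: "f2_subspace V" "finite V"
    and add1: "\<And>x x' z y. \<lbrakk>x \<in> V; x' \<in> V; z \<in> V; y \<in> V\<rbrakk> \<Longrightarrow> T (x + x') z y = T x z y + T x' z y"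
    and add3: "\<And>x z y y'. \<lbrakk>x \<in> V; z \<in> V; y \<in> V; y' \<in> V\<rbrakk> \<Longrightarrow> T x z (y + y') = T x z y + T x z y'"
    and sym: "\<And>x z y. \<lbrakk>x \<in> V; z \<in> V; y \<in> V\<rbrakk> \<Longrightarrow> T x z y = T z x y"
begin

lemma V_closed [simp]: "0 \<in> V" "x \<in> V \<Longrightarrow> y \<in> V \<Longrightarrow> x + y \<in> V"
  using V by (auto simp: f2_subspace_iff)

lemma V_sum: "(\<And>i. i \<in> A \<Longrightarrow> f i \<in> V) \<Longrightarrow> sum f A \<in> V"
  using V f2.subspace_sum by blast

lemma add2: "\<lbrakk>x \<in> V; z \<in> V; z' \<in> V; y \<in> V\<rbrakk> \<Longrightarrow> T x (z + z') y = T x z y + T x z' y"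
  using sym add1 V_closed by metis

lemma zero1: "z \<in> V \<Longrightarrow> y \<in> V \<Longrightarrow> T 0 z y = 0"
  using add1 [of 0 0 z y] by simp

lemma zero2: "x \<in> V \<Longrightarrow> y \<in> V \<Longrightarrow> T x 0 y = 0"
  using add2 [of x 0 0 y] by simp

lemma zero3: "x \<in> V \<Longrightarrow> z \<in> V \<Longrightarrow> T x z 0 = 0"
  using add3 [of x z 0 0] by simp

lemma sum1:
  assumes "finite A" "\<And>i. i \<in> A \<Longrightarrow> f i \<in> V" "z \<in> V" "y \<in> V"
  shows "T (sum f A) z y = (\<Sum>i\<in>A. T (f i) z y)"
  using assms by (induction A rule: finite_induct) (auto simp: zero1 add1 V_sum)

lemma sum2:
  assumes "finite A" "\<And>i. i \<in> A \<Longrightarrow> f i \<in> V" "x \<in> V" "y \<in> V"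
  shows "T x (sum f A) y = (\<Sum>i\<in>A. T x (f i) y)"
  using assms by (induction A rule: finite_induct) (auto simp: zero2 add2 V_sum)

text \<open>The number of distinct slices is \<open>2\<close> to the rank of the bilinear form \<open>T \<cdot> z \<cdot>\<close>.\<close>

definition slice :: "f2vec \<Rightarrow> f2vec \<Rightarrow> f2vec \<Rightarrow> bit" where
  "slice z x = restrict (T x z) V"

text \<open>The bilinear form of \<open>z\<close> has rank at most the binary logarithm of
  \<open>M\<close>. Counting slices instead of dimensions lets any labelling of slices bound the
  rank.\<close>

definition low :: "nat \<Rightarrow> f2vec set" where
  "low M = {z \<in> V. card (slice z ` V) \<le> M}"

lemma slice_eqD: "slice z x = slice z x' \<Longrightarrow> y \<in> V \<Longrightarrow> T x z y = T x' z y"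
  unfolding slice_def by (metis restrict_apply')

text \<open>The state of the greedy choice: \<open>N\<close> triples and the space \<open>U\<close>
  left for later ones. Distinct indices do not interact, and \<open>T (d i) (z i)\<close> kills
  later \<open>c j\<close>, which gives the triangular shape. The last clause makes every triple
  from \<open>U\<close> compatible with the earlier ones.\<close>

definition chain :: "nat \<Rightarrow> nat \<Rightarrow> f2vec set \<Rightarrow> (nat \<Rightarrow> f2vec) \<Rightarrow> (nat \<Rightarrow> f2vec) \<Rightarrow> (nat \<Rightarrow> f2vec) \<Rightarrow> bool" where
  "chain M N U d z c \<longleftrightarrow>
    f2_subspace U \<and> U \<subseteq> V \<and> card V \<le> (2 * M * M) ^ N * card U \<and>
    (\<forall>i<N. d i \<in> V \<and> z i \<in> V \<and> c i \<in> V \<and> T (d i) (z i) (c i) = 1) \<and>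
    (\<forall>i<N. \<forall>k<N. i \<noteq> k \<longrightarrow> (\<forall>y\<in>V. T (d i) (z k) y = 0)) \<and>
    (\<forall>i<N. \<forall>j<N. i < j \<longrightarrow> T (d i) (z i) (c j) = 0) \<and>
    (\<forall>i<N. \<forall>x\<in>U. (\<forall>y\<in>V. T x (z i) y = 0 \<and> T x (d i) y = 0) \<and> T (d i) (z i) x = 0)"

text \<open>The new space is the part of \<open>U\<close> killed by the three forms that the new
  triple determines. As \<open>d'\<close> and \<open>z'\<close> are low, two of these conditions
  split \<open>U\<close> into at most \<open>M\<close> classes each and the third into two, whence
  the factor \<open>2 * M * M\<close>.\<close>

lemma chain_extend:
  assumes ch: "chain M N U d z c"
    and new: "d' \<in> U \<inter> low M" "z' \<in> U \<inter> low M" "c' \<in> U" "T d' z' c' = 1"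
  shows "\<exists>U'. chain M (Suc N) U' (d(N := d')) (z(N := z')) (c(N := c'))"
proof -
  define U' where
    "U' = {x\<in>U. (\<forall>y\<in>V. T x z' y = 0 \<and> T x d' y = 0) \<and> T d' z' x = 0}"
  have U: "f2_subspace U" "U \<subseteq> V" "card V \<le> (2 * M * M) ^ N * card U"
    using ch by (auto simp: chain_def)
  have mem: "d' \<in> V" "z' \<in> V" "c' \<in> V"
    using U(2) new by auto
  have fin: "finite U"
    using U(2) V(2) finite_subset by blast
  have U'sub: "U' \<subseteq> U" and fin': "finite U'"
    using fin by (auto simp: U'_def)
  have "f2_subspace U'"
    unfolding f2_subspace_iff
  proof (intro conjI ballI)
    show "0 \<in> U'"
      using U mem by (auto simp: U'_def f2_subspace_iff zero1 zero3)
    fix x y assume "x \<in> U'" "y \<in> U'"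
    then show "x + y \<in> U'"
      using U mem by (auto simp: U'_def f2_subspace_iff add1 add3 subset_iff)
  qed
  moreover have "card U \<le> (2 * M * M) * card U'"
  proof -
    let ?P = "slice z' ` V \<times> slice d' ` V \<times> (UNIV :: bit set)"
    have "card U \<le> card ?P * card U'"
    proof (rule card_le_index_mult [OF fin fin'])
      show "finite ?P"
        using V(2) by (auto simp: UNIV_bit)
      show "(\<lambda>x. (slice z' x, slice d' x, T d' z' x)) ` U \<subseteq> ?P"
        using U(2) by auto
      fix x y assume xy: "x \<in> U" "y \<in> U"
        and eq: "(slice z' x, slice d' x, T d' z' x) = (slice z' y, slice d' y, T d' z' y)"
      have "x \<in> V" "y \<in> V" "x + y \<in> U"
        using xy U by (auto simp: f2_subspace_iff)
      moreover have "\<forall>w\<in>V. T x z' w = T y z' w \<and> T x d' w = T y d' w"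
        using eq slice_eqD by blast
      ultimately show "x + y \<in> U'"
        using mem eq by (simp add: U'_def add1 add3)
    qed
    also have "card ?P \<le> M * (M * 2)"
      unfolding card_cartesian_product
      using new by (intro mult_le_mono) (auto simp: low_def UNIV_bit)
    also have "M * (M * 2) = 2 * M * M"
      by simp
    finally show ?thesis
      by simp
  qed
  then have "(2 * M * M) ^ N * card U \<le> (2 * M * M) ^ N * ((2 * M * M) * card U')"
    by (rule mult_le_mono2)
  then have "card V \<le> (2 * M * M) ^ Suc N * card U'"
    using U(3) by (simp only: power_Suc2 mult.assoc)
  moreover have "T x (z i) y = 0 \<and> T x (d i) y = 0 \<and> T (d i) (z i) x = 0"
    if "i < N" "x \<in> U" "y \<in> V" for i x y
    using ch that by (auto simp: chain_def)
  \<comment> \<open>The invariant has \<open>d i\<close> in the second slot; the cross terms of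
    \<open>d i\<close> with the new \<open>z'\<close> need it in the first.\<close>
  moreover have "T (d i) x y = 0" if "i < N" "x \<in> U" "y \<in> V" for i x y
  proof -
    have "d i \<in> V" "x \<in> V"
      using ch that by (auto simp: chain_def)
    then show ?thesis
      using that sym ch by (auto simp: chain_def)
  qed
  moreover have "\<forall>x\<in>U'. (\<forall>y\<in>V. T x z' y = 0 \<and> T x d' y = 0) \<and> T d' z' x = 0"
    by (auto simp: U'_def)
  ultimately have "chain M (Suc N) U' (d(N := d')) (z(N := z')) (c(N := c'))"
    using ch new mem U'sub unfolding chain_def
    by (auto simp: less_Suc_eq subset_iff)
  then show ?thesis ..
qed

text \<open>Among the sums of the first \<open>a * m\<close> vectors \<open>z k\<close>, for
  \<open>a \<le> card Q\<close>, two have the same label, so the block \<open>Z\<close> between them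
  is low. But the block has at least \<open>m\<close> indices, and distinct sets of them give
  distinct slices of \<open>Z\<close>, more than \<open>M\<close> in all.\<close>

lemma chain_bounded:
  assumes ch: "chain M N U d z c"
    and Q: "finite Q" "q ` V \<subseteq> Q"
    and q: "\<And>z z'. z \<in> V \<Longrightarrow> z' \<in> V \<Longrightarrow> q z = q z' \<Longrightarrow> z + z' \<in> low M"
    and m: "M < 2 ^ m"
  shows "N < card Q * m"
proof (rule ccontr)
  assume "\<not> N < card Q * m"
  then have N: "card Q * m \<le> N" by simp
  define P where "P a = (\<Sum>k<a * m. z k)" for a
  have dz: "\<And>i. i < N \<Longrightarrow> d i \<in> V" "\<And>i. i < N \<Longrightarrow> z i \<in> V"
    using ch by (auto simp: chain_def)
  have le: "a * m \<le> N" if "a \<le> card Q" for a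
    using N that by (meson mult_le_mono1 order_trans)
  have PV: "P a \<in> V" if "a \<le> card Q" for a
    unfolding P_def using le [OF that] dz by (intro V_sum) auto
  have "(q \<circ> P) ` {..card Q} \<subseteq> Q"
    using PV Q by auto
  then have "\<not> inj_on (q \<circ> P) {..card Q}"
    by (metis Q(1) card_atMost card_inj_on_le lessI linorder_not_less)
  then obtain a b where ab: "a < b" "b \<le> card Q" "q (P a) = q (P b)"
    unfolding inj_on_def by (metis atMost_iff comp_apply linorder_neqE_nat)
  define I where "I = {a * m..<b * m}"
  define Z where "Z = sum z I"
  have "P b = P a + Z"
  proof -
    have "{..<b * m} = {..<a * m} \<union> I"
      using ab(1) by (simp add: I_def ivl_disj_un_one(2))
    moreover have "{..<a * m} \<inter> I = {}"
      by (auto simp: I_def)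
    ultimately show ?thesis
      by (simp add: P_def Z_def I_def sum.union_disjoint)
  qed
  then have "Z = P a + P b"
    by simp
  then have Zlow: "Z \<in> low M"
    using q [OF PV PV] ab by simp
  then have ZV: "Z \<in> V"
    by (simp add: low_def)
  have I: "finite I" "\<And>i. i \<in> I \<Longrightarrow> i < N"
    using le [OF ab(2)] by (auto simp: I_def)
  \<comment> \<open>Cross terms vanish, so against \<open>d i\<close> the whole block
    \<open>Z\<close> acts like \<open>z i\<close> alone.\<close>
  have val: "T (sum d A) Z y = (\<Sum>i\<in>A. T (d i) (z i) y)" if "A \<subseteq> I" "y \<in> V" for A y
  proof -
    have A: "finite A"
      using that I finite_subset by blast
    have "T (sum d A) Z y = (\<Sum>i\<in>A. T (d i) Z y)"
      using that A I dz ZV by (intro sum1) auto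
    also have "\<dots> = (\<Sum>i\<in>A. T (d i) (z i) y)"
    proof (rule sum.cong [OF refl])
      fix i assume i: "i \<in> A"
      have "T (d i) Z y = (\<Sum>k\<in>I. T (d i) (z k) y)"
        unfolding Z_def using that i I dz by (intro sum2) auto
      also have "\<dots> = (\<Sum>k\<in>I. if k = i then T (d i) (z i) y else 0)"
        using ch that i I by (intro sum.cong) (auto simp: chain_def)
      also have "\<dots> = T (d i) (z i) y"
        using that i I by auto
      finally show "T (d i) Z y = T (d i) (z i) y" .
    qed
    finally show ?thesis .
  qed
  have "inj_on (\<lambda>A. slice Z (sum d A)) (Pow I)"
  proof (rule inj_onI)
    fix A B assume A: "A \<in> Pow I" "B \<in> Pow I" "slice Z (sum d A) = slice Z (sum d B)"
    show "A = B"
    proof (rule sum_eq_imp_set_eq [of A B I "\<lambda>i. T (d i) (z i)" c])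
      show "finite A" "finite B"
        using A I finite_subset by auto
    next
      fix j assume j: "j \<in> I"
      then have "c j \<in> V"
        using ch I by (auto simp: chain_def)
      then show "(\<Sum>i\<in>A. T (d i) (z i) (c j)) = (\<Sum>i\<in>B. T (d i) (z i) (c j))"
        using slice_eqD [OF A(3)] val A by auto
    qed (use A ch I in \<open>auto simp: chain_def\<close>)
  qed
  moreover have "(\<lambda>A. slice Z (sum d A)) ` Pow I \<subseteq> slice Z ` V"
    using I dz by (auto intro!: imageI V_sum)
  ultimately have "card (Pow I) \<le> card (slice Z ` V)"
    using V(2) card_inj_on_le by blast
  also have "\<dots> \<le> M"
    using Zlow by (simp add: low_def)
  finally have "2 ^ ((b - a) * m) \<le> M"
    using I by (simp add: card_Pow I_def diff_mult_distrib)
  moreover have "(2::nat) ^ m \<le> 2 ^ ((b - a) * m)"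
    using ab by (intro power_increasing) auto
  ultimately show False
    using m by simp
qed

text \<open>For fixed \<open>z\<close> in \<open>L\<close>, linearity extends the first argument to
  the span; symmetry then lets the second argument follow.\<close>

lemma vanish_on_span:
  assumes U: "f2_subspace U" "U \<subseteq> V" and L: "L \<subseteq> U"
    and 0: "\<And>d z c. d \<in> L \<Longrightarrow> z \<in> L \<Longrightarrow> c \<in> U \<Longrightarrow> T d z c = 0"
    and d: "d \<in> f2_span L" and z: "z \<in> f2_span L" and c: "c \<in> U"
  shows "T d z c = 0"
proof -
  have sp: "f2_span L \<subseteq> V"
    using U L f2.span_minimal by blast
  have *: "f2_subspace {d \<in> V. T d z c = 0}" if "z \<in> V" for z
    using that U c by (auto simp: f2_subspace_iff zero1 add1)
  have **: "f2_span L \<subseteq> {d \<in> V. T d z c = 0}" if "z \<in> L" for z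
    using that U L c 0 * by (intro f2.span_minimal) (auto simp: subset_iff)
  have "f2_span L \<subseteq> {z \<in> V. T z d c = 0}"
    using ** d sp L U c sym by (intro f2.span_minimal *) (auto simp: subset_iff)
  then have "T z d c = 0"
    using z by blast
  then show ?thesis
    using sym [of d z c] z d sp c U by auto
qed

text \<open>A chain of maximal length admits no further triple, so \<open>T\<close> vanishes when
  its first two arguments lie in \<open>L = U \<inter> low M\<close> and the third in
  \<open>U\<close>. Two elements of \<open>U\<close> with the same label differ by an element of
  \<open>L\<close>, hence the span of \<open>L\<close> has index at most \<open>card Q\<close> in
  \<open>U\<close>.\<close>

lemma vanish_on_large_subspace:
  assumes Q: "finite Q" "q ` V \<subseteq> Q"
    and q: "\<And>z z'. z \<in> V \<Longrightarrow> z' \<in> V \<Longrightarrow> q z = q z' \<Longrightarrow> z + z' \<in> low M"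
    and m: "M < 2 ^ m" and M: "0 < M"
  shows "\<exists>U. f2_subspace U \<and> U \<subseteq> V \<and> card V \<le> (2 * M * M) ^ (card Q * m) * card Q * card U \<and>
    (\<forall>d\<in>U. \<forall>z\<in>U. \<forall>c\<in>U. T d z c = 0)"
proof -
  define R where "R N \<longleftrightarrow> (\<exists>U d z c. chain M N U d z c)" for N
  define N where "N = (GREATEST N. R N)"
  have "chain M 0 V (\<lambda>_. 0) (\<lambda>_. 0) (\<lambda>_. 0)"
    using V by (simp add: chain_def)
  then have R0: "R 0"
    unfolding R_def by blast
  have bound: "k \<le> card Q * m" if "R k" for k
    using that chain_bounded [OF _ Q q m] unfolding R_def by (blast intro: less_imp_le)
  have "R N"
    unfolding N_def using R0 bound by (rule GreatestI_nat)
  then obtain U d z c where ch: "chain M N U d z c"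
    unfolding R_def by blast
  have max: "k \<le> N" if "R k" for k
    unfolding N_def using that bound by (rule Greatest_le_nat)
  have N: "N \<le> card Q * m"
    using bound \<open>R N\<close> by blast
  have U: "f2_subspace U" "U \<subseteq> V" "card V \<le> (2 * M * M) ^ N * card U"
    using ch by (auto simp: chain_def)
  define L where "L = U \<inter> low M"
  have stop: "T d' z' c' = 0" if "d' \<in> L" "z' \<in> L" "c' \<in> U" for d' z' c'
  proof (rule ccontr)
    assume "T d' z' c' \<noteq> 0"
    then have "R (Suc N)"
      using chain_extend [OF ch, of d' z' c'] that unfolding L_def R_def
      by (metis bit_not_zero_iff)
    then show False
      using max [of "Suc N"] by simp
  qed
  have sp: "f2_span L \<subseteq> U"
    using U by (intro f2.span_minimal) (auto simp: L_def)
  have fin: "finite U" "finite (f2_span L)"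
    using sp U V(2) finite_subset by metis+
  have "card U \<le> card Q * card (f2_span L)"
  proof (rule card_le_index_mult [OF fin Q(1)])
    show "q ` U \<subseteq> Q"
      using Q U by auto
    fix x y assume "x \<in> U" "y \<in> U" "q x = q y"
    then have "x + y \<in> L"
      using U q by (auto simp: L_def f2_subspace_iff subset_iff)
    then show "x + y \<in> f2_span L"
      by (rule f2.span_base)
  qed
  then have "card V \<le> (2 * M * M) ^ N * (card Q * card (f2_span L))"
    using U(3) by (meson mult_le_mono2 order_trans)
  also have "\<dots> \<le> (2 * M * M) ^ (card Q * m) * (card Q * card (f2_span L))"
    using N M by (intro mult_le_mono1 power_increasing) auto
  finally have "card V \<le> (2 * M * M) ^ (card Q * m) * card Q * card (f2_span L)"
    by (simp add: mult.assoc)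
  moreover have "\<forall>d\<in>f2_span L. \<forall>z\<in>f2_span L. \<forall>c\<in>f2_span L. T d z c = 0"
  proof (intro ballI)
    fix d z c assume "d \<in> f2_span L" "z \<in> f2_span L" "c \<in> f2_span L"
    moreover have "L \<subseteq> U"
      by (simp add: L_def)
    ultimately show "T d z c = 0"
      using vanish_on_span [OF U(1,2) _ stop] sp by blast
  qed
  ultimately show ?thesis
    using sp U f2.subspace_span by blast
qed

end

section \<open>Multilinear forms and partition decompositions\<close>

text \<open>The only scalars are 0 and 1, and additivity at \<open>0 + 0\<close> settles the scalar
  0.\<close>

lemma multilinear_form_iff:
  assumes "0 \<in> V"
  shows "multilinear_form V I \<alpha> \<longleftrightarrow>
    (\<forall>x \<in> I \<rightarrow>\<^sub>E V. \<forall>j\<in>I. \<forall>u\<in>V. \<forall>v\<in>V. \<alpha> (x(j := u + v)) = \<alpha> (x(j := u)) + \<alpha> (x(j := v)))"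
    (is "_ \<longleftrightarrow> ?R")
proof
  assume R: ?R
  have "\<alpha> (x(j := 0)) = 0" if "x \<in> I \<rightarrow>\<^sub>E V" "j \<in> I" for x j
  proof -
    have "\<alpha> (x(j := 0 + 0)) = \<alpha> (x(j := 0)) + \<alpha> (x(j := 0))"
      using R that assms by blast
    then show ?thesis
      by simp
  qed
  then show "multilinear_form V I \<alpha>"
    using R by (simp add: multilinear_form_def f2_scale_bit)
qed (auto simp: multilinear_form_def)

lemma multilinear_form_add:
  "\<lbrakk>multilinear_form V I \<alpha>; x \<in> I \<rightarrow>\<^sub>E V; j \<in> I; u \<in> V; v \<in> V\<rbrakk>
    \<Longrightarrow> \<alpha> (x(j := u + v)) = \<alpha> (x(j := u)) + \<alpha> (x(j := v))"
  by (simp add: multilinear_form_def)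

lemma multilinear_form_mono:
  assumes "multilinear_form V I \<alpha>" "U \<subseteq> V"
  shows "multilinear_form U I \<alpha>"
proof -
  have "(I \<rightarrow>\<^sub>E U) \<subseteq> (I \<rightarrow>\<^sub>E V)"
    using assms(2) by (simp add: PiE_mono)
  then show ?thesis
    using assms by (auto simp: multilinear_form_def subset_iff)
qed

lemma symmetric_in_mono:
  assumes "symmetric_in V I J \<alpha>" "U \<subseteq> V"
  shows "symmetric_in U I J \<alpha>"
proof -
  have "(I \<rightarrow>\<^sub>E U) \<subseteq> (I \<rightarrow>\<^sub>E V)"
    using assms(2) by (simp add: PiE_mono)
  then show ?thesis
    using assms by (auto simp: symmetric_in_def subset_iff)
qed

lemma multilinear_form_plus:
  assumes "multilinear_form V I \<alpha>" "multilinear_form V I \<beta>"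
  shows "multilinear_form V I (\<lambda>x. \<alpha> x + \<beta> x)"
  unfolding multilinear_form_def
proof (intro ballI conjI allI)
  fix x j u v assume *: "x \<in> I \<rightarrow>\<^sub>E V" "j \<in> I" "u \<in> V" "v \<in> V"
  show "\<alpha> (x(j := u + v)) + \<beta> (x(j := u + v)) =
    \<alpha> (x(j := u)) + \<beta> (x(j := u)) + (\<alpha> (x(j := v)) + \<beta> (x(j := v)))"
    unfolding multilinear_form_add [OF assms(1) *] multilinear_form_add [OF assms(2) *]
    by (simp only: ac_simps)
next
  fix x j c u assume "x \<in> I \<rightarrow>\<^sub>E V" "j \<in> I" "u \<in> V"
  then have "\<alpha> (x(j := f2_scale c u)) = c * \<alpha> (x(j := u))"
    "\<beta> (x(j := f2_scale c u)) = c * \<beta> (x(j := u))"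
    using assms unfolding multilinear_form_def by blast+
  then show "\<alpha> (x(j := f2_scale c u)) + \<beta> (x(j := f2_scale c u)) = c * (\<alpha> (x(j := u)) + \<beta> (x(j := u)))"
    by (simp only: distrib_left)
qed

lemma multilinear_form_sum:
  assumes "\<And>a. a \<in> A \<Longrightarrow> multilinear_form V I (\<alpha> a)"
  shows "multilinear_form V I (\<lambda>x. \<Sum>a\<in>A. \<alpha> a x)"
  unfolding multilinear_form_def
proof (intro ballI conjI allI)
  fix x j u v assume *: "x \<in> I \<rightarrow>\<^sub>E V" "j \<in> I" "u \<in> V" "v \<in> V"
  have "(\<Sum>a\<in>A. \<alpha> a (x(j := u + v))) = (\<Sum>a\<in>A. \<alpha> a (x(j := u)) + \<alpha> a (x(j := v)))"
    using assms * by (intro sum.cong refl) (rule multilinear_form_add)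
  then show "(\<Sum>a\<in>A. \<alpha> a (x(j := u + v))) = (\<Sum>a\<in>A. \<alpha> a (x(j := u))) + (\<Sum>a\<in>A. \<alpha> a (x(j := v)))"
    by (simp only: sum.distrib)
next
  fix x j c u assume *: "x \<in> I \<rightarrow>\<^sub>E V" "j \<in> I" "u \<in> V"
  have "(\<Sum>a\<in>A. \<alpha> a (x(j := f2_scale c u))) = (\<Sum>a\<in>A. c * \<alpha> a (x(j := u)))"
    using assms * unfolding multilinear_form_def by (intro sum.cong refl) blast
  then show "(\<Sum>a\<in>A. \<alpha> a (x(j := f2_scale c u))) = c * (\<Sum>a\<in>A. \<alpha> a (x(j := u)))"
    by (simp only: sum_distrib_left)
qed

text \<open>The two cross terms are exchanged by the swap, so they are equal and cancel in
  characteristic 2. This is what makes the diagonal of a symmetric form multilinear.\<close>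

lemma additive_on_pair:
  assumes V: "f2_subspace V" and \<alpha>: "multilinear_form V I \<alpha>"
    and sw: "\<And>x. x \<in> I \<rightarrow>\<^sub>E V \<Longrightarrow> \<alpha> (x \<circ> transpose p q) = \<alpha> x"
    and pq: "p \<in> I" "q \<in> I" "p \<noteq> q" and x: "x \<in> I \<rightarrow>\<^sub>E V" and uv: "u \<in> V" "v \<in> V"
  shows "\<alpha> (x(p := u + v, q := u + v)) = \<alpha> (x(p := u, q := u)) + \<alpha> (x(p := v, q := v))"
proof -
  have mem: "x(p := a) \<in> I \<rightarrow>\<^sub>E V" "x(q := a) \<in> I \<rightarrow>\<^sub>E V" "x(p := a, q := b) \<in> I \<rightarrow>\<^sub>E V"
    if "a \<in> V" "b \<in> V" for a b
    using x that pq by (auto simp: PiE_iff extensional_def)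
  have V2: "u + v \<in> V"
    using V uv by (auto simp: f2_subspace_iff)
  have "x(p := u, q := v) \<circ> transpose p q = x(p := v, q := u)"
    using pq by (auto simp: fun_eq_iff transpose_def)
  then have sym: "\<alpha> (x(p := v, q := u)) = \<alpha> (x(p := u, q := v))"
    using sw [OF mem(3) [OF uv]] by simp
  have p: "\<alpha> (x(p := u + v, q := a)) = \<alpha> (x(p := u, q := a)) + \<alpha> (x(p := v, q := a))"
    if "a \<in> V" for a
    using multilinear_form_add [OF \<alpha> mem(2) [OF that that] pq(1) uv] pq(3)
    by (simp add: fun_upd_twist)
  have q: "\<alpha> (x(p := a, q := u + v)) = \<alpha> (x(p := a, q := u)) + \<alpha> (x(p := a, q := v))"
    if "a \<in> V" for a
    using multilinear_form_add [OF \<alpha> mem(1) [OF that that] pq(2) uv] .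
  have "\<alpha> (x(p := u + v, q := u + v)) =
    (\<alpha> (x(p := u, q := u)) + \<alpha> (x(p := v, q := u))) + (\<alpha> (x(p := u, q := v)) + \<alpha> (x(p := v, q := v)))"
    using q [OF V2] p uv by simp
  also have "\<dots> = \<alpha> (x(p := u, q := u)) + \<alpha> (x(p := v, q := v))
      + (\<alpha> (x(p := u, q := v)) + \<alpha> (x(p := u, q := v)))"
    unfolding sym by (simp only: ac_simps)
  finally show ?thesis
    by simp
qed

lemma ex_permutes_pair:
  assumes "a \<in> A" "b \<in> A" "a \<noteq> b" "p \<in> A" "q \<in> A" "p \<noteq> q"
  shows "\<exists>\<pi>. \<pi> permutes A \<and> \<pi> a = p \<and> \<pi> b = q"
proof -
  let ?\<tau> = "transpose a p"
  \<comment> \<open>The inner swap sends \<open>b\<close> to the point that \<open>?\<tau>\<close>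
    takes to \<open>q\<close>. It fixes \<open>a\<close>, because \<open>?\<tau> q = a\<close> only
    for \<open>q = p\<close>.\<close>
  let ?\<pi> = "?\<tau> \<circ> transpose b (?\<tau> q)"
  have "?\<tau> q \<in> A"
    using assms by (auto simp: transpose_def)
  then have "?\<pi> permutes A"
    using assms by (intro permutes_compose permutes_swap_id) auto
  moreover have "?\<pi> a = p \<and> ?\<pi> b = q"
    using assms by (auto simp: transpose_def)
  ultimately show ?thesis
    by blast
qed

lemma has_partition_decomposition_0:
  "has_partition_decomposition V I \<alpha> 0 \<longleftrightarrow> (\<forall>x \<in> I \<rightarrow>\<^sub>E V. \<alpha> x = 0)"
  by (simp add: has_partition_decomposition_def)

lemma has_partition_decomposition_add:
  assumes "has_partition_decomposition V I \<alpha> m" "has_partition_decomposition V I \<alpha>' n"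
  shows "has_partition_decomposition V I (\<lambda>x. \<alpha> x + \<alpha>' x) (m + n)"
proof -
  obtain S \<beta> \<gamma> where 1: "\<forall>i<m. S i \<noteq> {} \<and> S i \<subset> I \<and>
        multilinear_form V (S i) (\<beta> i) \<and> multilinear_form V (I - S i) (\<gamma> i)"
      "\<forall>x \<in> I \<rightarrow>\<^sub>E V. \<alpha> x = (\<Sum>i<m. \<beta> i (restrict x (S i)) * \<gamma> i (restrict x (I - S i)))"
    using assms(1) unfolding has_partition_decomposition_def by blast
  obtain S' \<beta>' \<gamma>' where 2: "\<forall>i<n. S' i \<noteq> {} \<and> S' i \<subset> I \<and>
        multilinear_form V (S' i) (\<beta>' i) \<and> multilinear_form V (I - S' i) (\<gamma>' i)"
      "\<forall>x \<in> I \<rightarrow>\<^sub>E V. \<alpha>' x = (\<Sum>i<n. \<beta>' i (restrict x (S' i)) * \<gamma>' i (restrict x (I - S' i)))"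
    using assms(2) unfolding has_partition_decomposition_def by blast
  have split: "(\<Sum>i<m + n. f i) = (\<Sum>i<m. f i) + (\<Sum>i<n. f (m + i))" for f :: "nat \<Rightarrow> bit"
    by (induction n) (auto simp: add.assoc)
  define S'' where "S'' i = (if i < m then S i else S' (i - m))" for i
  define \<beta>'' where "\<beta>'' i = (if i < m then \<beta> i else \<beta>' (i - m))" for i
  define \<gamma>'' where "\<gamma>'' i = (if i < m then \<gamma> i else \<gamma>' (i - m))" for i
  have "\<forall>i<m + n. S'' i \<noteq> {} \<and> S'' i \<subset> I \<and>
      multilinear_form V (S'' i) (\<beta>'' i) \<and> multilinear_form V (I - S'' i) (\<gamma>'' i)"
  proof (intro allI impI)
    fix i assume "i < m + n"
    then show "S'' i \<noteq> {} \<and> S'' i \<subset> I \<and>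
      multilinear_form V (S'' i) (\<beta>'' i) \<and> multilinear_form V (I - S'' i) (\<gamma>'' i)"
      using 1(1) 2(1) [rule_format, of "i - m"] by (cases "i < m") (auto simp: S''_def \<beta>''_def \<gamma>''_def)
  qed
  moreover have "\<forall>x \<in> I \<rightarrow>\<^sub>E V. \<alpha> x + \<alpha>' x =
      (\<Sum>i<m + n. \<beta>'' i (restrict x (S'' i)) * \<gamma>'' i (restrict x (I - S'' i)))"
    using 1(2) 2(2) by (simp add: split S''_def \<beta>''_def \<gamma>''_def)
  ultimately show ?thesis
    unfolding has_partition_decomposition_def by blast
qed

lemma has_partition_decomposition_sum:
  assumes "finite A" "\<And>a. a \<in> A \<Longrightarrow> has_partition_decomposition V I (\<alpha> a) r"
  shows "has_partition_decomposition V I (\<lambda>x. \<Sum>a\<in>A. \<alpha> a x) (card A * r)"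
  using assms
proof (induction A rule: finite_induct)
  case empty
  then show ?case
    by (simp add: has_partition_decomposition_0)
next
  case (insert a A)
  then show ?case
    using has_partition_decomposition_add [of V I "\<alpha> a" r "\<lambda>x. \<Sum>a\<in>A. \<alpha> a x" "card A * r"]
    by simp
qed

lemma has_partition_decomposition_cong:
  assumes "has_partition_decomposition V I \<alpha> m" "\<And>x. x \<in> I \<rightarrow>\<^sub>E V \<Longrightarrow> \<alpha> x = \<alpha>' x"
  shows "has_partition_decomposition V I \<alpha>' m"
  using assms by (simp add: has_partition_decomposition_def)

lemma multilinear_form_cong:
  assumes "multilinear_form V I \<alpha>" "0 \<in> V" "f2_subspace V" "\<And>x. x \<in> I \<rightarrow>\<^sub>E V \<Longrightarrow> \<alpha> x = \<alpha>' x"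
  shows "multilinear_form V I \<alpha>'"
  unfolding multilinear_form_iff [OF assms(2)]
proof (intro ballI)
  fix x j u v assume *: "x \<in> I \<rightarrow>\<^sub>E V" "j \<in> I" "u \<in> V" "v \<in> V"
  have "x(j := w) \<in> I \<rightarrow>\<^sub>E V" if "w \<in> V" for w
    using * that by (auto simp: PiE_iff extensional_def)
  moreover have "u + v \<in> V"
    using * assms(3) by (simp add: f2_subspace_iff)
  ultimately show "\<alpha>' (x(j := u + v)) = \<alpha>' (x(j := u)) + \<alpha>' (x(j := v))"
    using multilinear_form_add [OF assms(1) *] assms(4) * by metis
qed

text \<open>
  \<open>Y\<close> turns a family indexed by \<open>I'\<close> into one indexed by \<open>I\<close>; its \<open>j\<close>th entry is multilinear in
  the entries of the argument with index in the fibre of \<open>\<sigma>\<close> over \<open>j\<close>.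
\<close>

locale family_subst =
  fixes U V :: "f2vec set" and I I' :: "nat set" and \<sigma> :: "nat \<Rightarrow> nat"
    and Y :: "(nat \<Rightarrow> f2vec) \<Rightarrow> nat \<Rightarrow> f2vec"
  assumes UV: "f2_subspace U" "f2_subspace V"
    and surj: "\<sigma> ` I' = I"
    and closed: "\<And>x j. j \<in> I \<Longrightarrow> (\<And>l. l \<in> I' \<Longrightarrow> \<sigma> l = j \<Longrightarrow> x l \<in> U) \<Longrightarrow> Y x j \<in> V"
    and cong: "\<And>x x' j. j \<in> I \<Longrightarrow> (\<And>l. l \<in> I' \<Longrightarrow> \<sigma> l = j \<Longrightarrow> x l = x' l) \<Longrightarrow> Y x j = Y x' j"
    and lin: "\<And>x l u v. l \<in> I' \<Longrightarrow> (\<And>k. k \<in> I' \<Longrightarrow> \<sigma> k = \<sigma> l \<Longrightarrow> x k \<in> U) \<Longrightarrow> u \<in> U \<Longrightarrow> v \<in> U \<Longrightarrow>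
      Y (x(l := u + v)) (\<sigma> l) = Y (x(l := u)) (\<sigma> l) + Y (x(l := v)) (\<sigma> l)"
begin

definition fibre :: "nat set \<Rightarrow> nat set" where
  "fibre S = {l \<in> I'. \<sigma> l \<in> S}"

text \<open>Changing the argument at \<open>l\<close> alters only the entry
  \<open>\<sigma> l\<close> of \<open>Y x\<close>, and alters it additively.\<close>

lemma multilinear_pullback:
  assumes "S \<subseteq> I" "multilinear_form V S \<beta>"
  shows "multilinear_form U (fibre S) (\<lambda>x. \<beta> (restrict (Y x) S))"
proof -
  have 0: "0 \<in> U"
    using UV by (auto simp: f2_subspace_iff)
  show ?thesis
    unfolding multilinear_form_iff [OF 0]
  proof (intro ballI)
    fix x l u v
    assume x: "x \<in> fibre S \<rightarrow>\<^sub>E U" and l: "l \<in> fibre S" and uv: "u \<in> U" "v \<in> U"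
    have l': "l \<in> I'" "\<sigma> l \<in> S"
      using l by (auto simp: fibre_def)
    have cl: "Y (x(l := w)) j \<in> V" if "w \<in> U" "j \<in> S" for w j
      using that x assms(1) by (intro closed) (auto simp: fibre_def PiE_iff)
    have clx: "Y x j \<in> V" if "j \<in> S" for j
      using that x assms(1) by (intro closed) (auto simp: fibre_def PiE_iff)
    have eq: "restrict (Y (x(l := w))) S = (restrict (Y x) S)(\<sigma> l := Y (x(l := w)) (\<sigma> l))" for w
    proof
      fix j
      have "Y (x(l := w)) j = Y x j" if "j \<in> S" "j \<noteq> \<sigma> l"
        using that assms(1) by (intro cong) auto
      then show "restrict (Y (x(l := w))) S j = ((restrict (Y x) S)(\<sigma> l := Y (x(l := w)) (\<sigma> l))) j"
        using l' by auto
    qed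
    have fam: "restrict (Y x) S \<in> S \<rightarrow>\<^sub>E V"
      using clx by auto
    have "Y (x(l := u + v)) (\<sigma> l) = Y (x(l := u)) (\<sigma> l) + Y (x(l := v)) (\<sigma> l)"
      using x l' uv by (intro lin) (auto simp: fibre_def PiE_iff)
    then show "\<beta> (restrict (Y (x(l := u + v))) S) =
      \<beta> (restrict (Y (x(l := u))) S) + \<beta> (restrict (Y (x(l := v))) S)"
      unfolding eq
      using multilinear_form_add [OF assms(2) fam l'(2) cl [OF uv(1) l'(2)] cl [OF uv(2) l'(2)]]
      by simp
  qed
qed

lemma fibre_all: "fibre I = I'"
  using surj by (auto simp: fibre_def)

text \<open>Each factor is pulled back separately, so the number of terms stays the same. Fibres
  over complementary sets are complementary, and surjectivity of \<open>\<sigma>\<close> keeps them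
  non-empty and proper.\<close>

lemma has_partition_decomposition_pullback:
  assumes "has_partition_decomposition V I D r"
  shows "has_partition_decomposition U I' (\<lambda>x. D (restrict (Y x) I)) r"
proof -
  obtain S \<beta> \<gamma> where *: "\<forall>i<r. S i \<noteq> {} \<and> S i \<subset> I \<and>
        multilinear_form V (S i) (\<beta> i) \<and> multilinear_form V (I - S i) (\<gamma> i)"
      "\<forall>x \<in> I \<rightarrow>\<^sub>E V. D x = (\<Sum>i<r. \<beta> i (restrict x (S i)) * \<gamma> i (restrict x (I - S i)))"
    using assms unfolding has_partition_decomposition_def by blast
  have compl: "I' - fibre T = fibre (I - T)" for T
    using surj by (auto simp: fibre_def)
  have restr: "restrict (Y (restrict x (fibre T))) T = restrict (Y x) T" if "T \<subseteq> I" for T x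
  proof
    fix j
    have "Y (restrict x (fibre T)) j = Y x j" if "j \<in> T"
      using that \<open>T \<subseteq> I\<close> by (intro cong) (auto simp: fibre_def)
    then show "restrict (Y (restrict x (fibre T))) T j = restrict (Y x) T j"
      by simp
  qed
  have "fibre (S i) \<noteq> {} \<and> fibre (S i) \<subset> I' \<and>
      multilinear_form U (fibre (S i)) (\<lambda>x. \<beta> i (restrict (Y x) (S i))) \<and>
      multilinear_form U (I' - fibre (S i)) (\<lambda>x. \<gamma> i (restrict (Y x) (I - S i)))" if "i < r" for i
  proof (intro conjI)
    have S: "S i \<noteq> {}" "S i \<subset> I"
      using * that by auto
    show "fibre (S i) \<noteq> {}" "fibre (S i) \<subset> I'"
      using S surj by (force simp: fibre_def)+
    show "multilinear_form U (fibre (S i)) (\<lambda>x. \<beta> i (restrict (Y x) (S i)))"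
      using * that by (intro multilinear_pullback) auto
    show "multilinear_form U (I' - fibre (S i)) (\<lambda>x. \<gamma> i (restrict (Y x) (I - S i)))"
      unfolding compl using * that by (intro multilinear_pullback) auto
  qed
  moreover have "D (restrict (Y x) I) =
    (\<Sum>i<r. \<beta> i (restrict (Y (restrict x (fibre (S i)))) (S i)) *
       \<gamma> i (restrict (Y (restrict x (I' - fibre (S i)))) (I - S i)))"
    if x: "x \<in> I' \<rightarrow>\<^sub>E U" for x
  proof -
    have "restrict (Y x) I \<in> I \<rightarrow>\<^sub>E V"
      using x by (auto intro!: closed)
    then have "D (restrict (Y x) I) = (\<Sum>i<r. \<beta> i (restrict (restrict (Y x) I) (S i)) *
        \<gamma> i (restrict (restrict (Y x) I) (I - S i)))"
      using * by blast
    also have "\<dots> = (\<Sum>i<r. \<beta> i (restrict (Y (restrict x (fibre (S i)))) (S i)) *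
       \<gamma> i (restrict (Y (restrict x (I' - fibre (S i)))) (I - S i)))"
    proof (rule sum.cong [OF refl])
      fix i assume "i \<in> {..<r}"
      then have "S i \<subseteq> I"
        using * by auto
      then show "\<beta> i (restrict (restrict (Y x) I) (S i)) * \<gamma> i (restrict (restrict (Y x) I) (I - S i)) =
        \<beta> i (restrict (Y (restrict x (fibre (S i)))) (S i)) *
        \<gamma> i (restrict (Y (restrict x (I' - fibre (S i)))) (I - S i))"
        by (simp add: compl restr Int_absorb1)
    qed
    finally show ?thesis .
  qed
  ultimately show ?thesis
    unfolding has_partition_decomposition_def
    by (intro exI [of _ "\<lambda>i. fibre (S i)"] exI [of _ "\<lambda>i x. \<beta> i (restrict (Y x) (S i))"]
        exI [of _ "\<lambda>i x. \<gamma> i (restrict (Y x) (I - S i))"]) auto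
qed

end

section \<open>Passing to the common kernel of single-variable factors\<close>

lemma single_variable_add:
  assumes "multilinear_form V S \<beta>" "card S = 1" "f2_subspace V" "u \<in> V" "v \<in> V"
  shows "\<beta> (restrict (\<lambda>_. u + v) S) = \<beta> (restrict (\<lambda>_. u) S) + \<beta> (restrict (\<lambda>_. v) S)"
proof -
  obtain s where s: "S = {s}"
    using assms(2) card_1_singletonE by blast
  have eq: "restrict (\<lambda>_. w) S = (restrict (\<lambda>_. u) S)(s := w)" for w
    by (auto simp: s fun_eq_iff)
  have "restrict (\<lambda>_. u) S \<in> S \<rightarrow>\<^sub>E V"
    using assms by auto
  then have "\<beta> ((restrict (\<lambda>_. u) S)(s := u + v)) =
      \<beta> ((restrict (\<lambda>_. u) S)(s := u)) + \<beta> ((restrict (\<lambda>_. u) S)(s := v))"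
    using assms s by (intro multilinear_form_add) auto
  then show ?thesis
    by (simp only: eq [symmetric])
qed

text \<open>\<open>W\<close> is the common kernel of the linear forms that occur as single-variable
  factors, one for each such term. Labelling vectors by the values of these forms gives the index
  bound.\<close>

lemma kill_single_variable_factors:
  assumes V: "f2_subspace V" "finite V" and dec: "has_partition_decomposition V I D r" and a: "a \<in> I"
  shows "\<exists>W S \<beta> \<gamma>. f2_subspace W \<and> W \<subseteq> V \<and> card V \<le> 2 ^ r * card W \<and>
    (\<forall>i<r. a \<in> S i \<and> S i \<subset> I) \<and>
    (\<forall>x \<in> I \<rightarrow>\<^sub>E V. D x = (\<Sum>i<r. \<beta> i (restrict x (S i)) * \<gamma> i (restrict x (I - S i)))) \<and>
    (\<forall>i<r. \<forall>x \<in> I \<rightarrow>\<^sub>E W. card (S i) = 1 \<or> card (I - S i) = 1 \<longrightarrow>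
      \<beta> i (restrict x (S i)) * \<gamma> i (restrict x (I - S i)) = (0::bit))"
proof -
  obtain S0 \<beta>0 \<gamma>0 where *: "\<forall>i<r. S0 i \<noteq> {} \<and> S0 i \<subset> I \<and>
        multilinear_form V (S0 i) (\<beta>0 i) \<and> multilinear_form V (I - S0 i) (\<gamma>0 i)"
      "\<forall>x \<in> I \<rightarrow>\<^sub>E V. D x = (\<Sum>i<r. \<beta>0 i (restrict x (S0 i)) * \<gamma>0 i (restrict x (I - S0 i)))"
    using dec unfolding has_partition_decomposition_def by blast
  \<comment> \<open>Factors are exchanged where necessary so that the variable \<open>a\<close>
    always belongs to the first one.\<close>
  define S where "S i = (if a \<in> S0 i then S0 i else I - S0 i)" for i
  define \<beta> where "\<beta> i = (if a \<in> S0 i then \<beta>0 i else \<gamma>0 i)" for i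
  define \<gamma> where "\<gamma> i = (if a \<in> S0 i then \<gamma>0 i else \<beta>0 i)" for i
  have dbl: "I - (I - S0 i) = S0 i" if "i < r" for i
    using * that by auto
  have S: "a \<in> S i" "S i \<subset> I" "multilinear_form V (S i) (\<beta> i)" "multilinear_form V (I - S i) (\<gamma> i)"
    if "i < r" for i
    using * that a dbl [OF that] by (auto simp: S_def \<beta>_def \<gamma>_def)
  have D: "D x = (\<Sum>i<r. \<beta> i (restrict x (S i)) * \<gamma> i (restrict x (I - S i)))" if "x \<in> I \<rightarrow>\<^sub>E V" for x
  proof -
    have "D x = (\<Sum>i<r. \<beta>0 i (restrict x (S0 i)) * \<gamma>0 i (restrict x (I - S0 i)))"
      using * that by blast
    also have "\<dots> = (\<Sum>i<r. \<beta> i (restrict x (S i)) * \<gamma> i (restrict x (I - S i)))"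
      by (intro sum.cong refl) (auto simp: S_def \<beta>_def \<gamma>_def dbl mult.commute)
    finally show ?thesis .
  qed
  \<comment> \<open>A one-variable form is evaluated on a constant family, so its index need not be
    named. The value 0 imposes no condition when neither factor has a single variable.\<close>
  define h where "h i x = (if card (S i) = 1 then \<beta> i (restrict (\<lambda>_. x) (S i))
    else if card (I - S i) = 1 then \<gamma> i (restrict (\<lambda>_. x) (I - S i)) else 0)" for i x
  have h_add: "h i (x + y) = h i x + h i y" if "i < r" "x \<in> V" "y \<in> V" for i x y
    using single_variable_add [OF S(3) [OF that(1)] _ V(1) that(2,3)]
      single_variable_add [OF S(4) [OF that(1)] _ V(1) that(2,3)]
    by (auto simp: h_def)
  have h_0: "h i 0 = 0" if "i < r" for i
    using h_add [OF that, of 0 0] V by (auto simp: f2_subspace_iff)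
  define W where "W = {x\<in>V. \<forall>i<r. h i x = 0}"
  have W: "f2_subspace W" "W \<subseteq> V"
    using V h_add h_0 by (auto simp: W_def f2_subspace_iff)
  have "card V \<le> card (Pow {..<r}) * card W"
  proof (rule card_le_index_mult [where \<phi> = "\<lambda>x. {i. i < r \<and> h i x = 1}"])
    show "finite W"
      using W V(2) finite_subset by blast
    fix x y assume xy: "x \<in> V" "y \<in> V" "{i. i < r \<and> h i x = 1} = {i. i < r \<and> h i y = 1}"
    have "h i x = h i y" if "i < r" for i
    proof -
      have "h i x = 1 \<longleftrightarrow> h i y = 1"
        using xy(3) that by blast
      then show ?thesis
        by (metis bit_not_zero_iff)
    qed
    then show "x + y \<in> W"
      using xy V h_add by (auto simp: W_def f2_subspace_iff)
  qed (use V in auto)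
  then have "card V \<le> 2 ^ r * card W"
    by (simp add: card_Pow)
  moreover have "\<beta> i (restrict x (S i)) * \<gamma> i (restrict x (I - S i)) = 0"
    if i: "i < r" and x: "x \<in> I \<rightarrow>\<^sub>E W" and c: "card (S i) = 1 \<or> card (I - S i) = 1" for i x
  proof -
    have hx: "h i (x j) = 0" if "j \<in> I" for j
      using that x i by (auto simp: W_def PiE_iff)
    have const: "restrict x {j} = restrict (\<lambda>_. x j) {j}" for j
      by (auto simp: fun_eq_iff)
    show ?thesis
    proof (cases "card (S i) = 1")
      case True
      then obtain s where s: "S i = {s}"
        using card_1_singletonE by blast
      then have "\<beta> i (restrict x (S i)) = h i (x s)"
        by (simp add: h_def const)
      also have "\<dots> = 0"
        using hx S(2) [OF i] s by auto
      finally show ?thesis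
        by simp
    next
      case False
      then obtain s where s: "I - S i = {s}"
        using c card_1_singletonE by blast
      then have "\<gamma> i (restrict x (I - S i)) = h i (x s)"
        using False by (simp add: h_def const)
      also have "\<dots> = 0"
        using hx s by auto
      finally show ?thesis
        by simp
    qed
  qed
  ultimately show ?thesis
    using W S D by (intro exI [of _ W] exI [of _ S] exI [of _ \<beta>] exI [of _ \<gamma>]) auto
qed

section \<open>Forms in five variables\<close>

text \<open>A finite infimum is attained. The length \<open>r'\<close> is not padded to
  \<open>r\<close>: when \<open>I\<close> is a singleton there are no admissible sets, so only
  length 0 occurs.\<close>

lemma prank_le_enat_iff:
  "prank V I \<alpha> \<le> enat r \<longleftrightarrow> (\<exists>r'\<le>r. has_partition_decomposition V I \<alpha> r')"
proof
  assume *: "prank V I \<alpha> \<le> enat r"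
  let ?X = "enat ` {m. has_partition_decomposition V I \<alpha> m}"
  have "?X \<noteq> {}"
    using * unfolding prank_def Inf_enat_def by (metis enat_ord_simps(5) infinity_ileE)
  then have "Inf ?X \<in> ?X"
    unfolding Inf_enat_def by (metis (mono_tags, lifting) LeastI_ex ex_in_conv)
  then show "\<exists>r'\<le>r. has_partition_decomposition V I \<alpha> r'"
    using * by (auto simp: prank_def)
next
  assume "\<exists>r'\<le>r. has_partition_decomposition V I \<alpha> r'"
  then obtain r' where r': "r' \<le> r" "has_partition_decomposition V I \<alpha> r'"
    by blast
  then have "prank V I \<alpha> \<le> enat r'"
    unfolding prank_def by (intro Inf_lower) auto
  then show "prank V I \<alpha> \<le> enat r"
    using r' by (meson enat_ord_simps(1) order_trans)
qed

section \<open>Coordinatewise products with respect to a basis\<close>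

locale f2_basis =
  fixes U B :: "f2vec set"
  assumes U: "f2_subspace U"
    and B: "finite B" "B \<subseteq> U" "\<not> f2_dependent B" "U \<subseteq> f2_span B"
begin

text \<open>
  The coordinatewise product in the basis \<open>B\<close> of the vectors \<open>x\<^sub>i\<close> with \<open>i \<in> e\<close>.
\<close>

definition meet :: "nat set \<Rightarrow> (nat \<Rightarrow> f2vec) \<Rightarrow> f2vec" where
  "meet e x = (\<Sum>b\<in>B. f2_scale (\<Prod>i\<in>e. f2.representation B (x i) b) b)"

lemma meet_in: "meet e x \<in> U"
  unfolding meet_def using U B by (intro f2.subspace_sum f2.subspace_scale) auto

lemma meet_cong: "(\<And>i. i \<in> e \<Longrightarrow> x i = x' i) \<Longrightarrow> meet e x = meet e x'"
  by (simp add: meet_def)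

lemma meet_add:
  assumes "finite e" "l \<in> e" "u \<in> U" "v \<in> U"
  shows "meet e (x(l := u + v)) = meet e (x(l := u)) + meet e (x(l := v))"
proof -
  have prod: "(\<Prod>i\<in>e. f2.representation B ((x(l := w)) i) b) =
    f2.representation B w b * (\<Prod>i\<in>e - {l}. f2.representation B (x i) b)" for w b
    using assms by (subst prod.remove [of e l]) (auto intro!: prod.cong)
  have "f2.representation B (u + v) b = f2.representation B u b + f2.representation B v b" for b
    using f2.representation_add [OF B(3), of v u] assms B(4) subsetD by metis
  then show ?thesis
    unfolding meet_def prod by (simp only: distrib_right f2.scale_left_distrib sum.distrib)
qed

lemma meet_const:
  assumes "finite e" "e \<noteq> {}" "\<And>i. i \<in> e \<Longrightarrow> x i = w" "w \<in> U"
  shows "meet e x = w"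
proof -
  \<comment> \<open>Every element of F_2 is idempotent; the exponent is positive because
    \<open>e\<close> is finite and non-empty.\<close>
  have idem: "c ^ card e = c" for c :: bit
    using assms by (cases c) (auto simp: card_gt_0_iff zero_power)
  have "(\<Prod>i\<in>e. f2.representation B (x i) b) = f2.representation B w b" for b
  proof -
    have "(\<Prod>i\<in>e. f2.representation B (x i) b) = (\<Prod>i\<in>e. f2.representation B w b)"
      using assms by (intro prod.cong) auto
    then show ?thesis
      by (simp only: prod_constant idem)
  qed
  then show ?thesis
    using f2.sum_representation_eq [OF B(3) _ B(1) order_refl] assms(4) B by (auto simp: meet_def)
qed

lemma meet_image:
  assumes "inj_on \<pi> e"
  shows "meet e (x \<circ> \<pi>) = meet (\<pi> ` e) x"
  using assms by (simp add: meet_def prod.reindex)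

end

definition dup :: "f2vec \<Rightarrow> f2vec \<Rightarrow> f2vec \<Rightarrow> nat \<Rightarrow> f2vec" where
  "dup d z c = (\<lambda>i\<in>{1..5}. if i \<le> 2 then d else if i \<le> 4 then z else c)"

lemma upto_4: "{1..4::nat} = {1, 2, 3, 4}"
  by auto

locale five_form =
  fixes V :: "f2vec set" and \<alpha> :: form and m :: nat
  assumes V: "f2_subspace V" "finite V"
    and \<alpha>: "multilinear_form V {1..5} \<alpha>"
    and sym: "symmetric_in V {1..5} {1..m} \<alpha>"
    and m: "2 \<le> m" "m \<le> 5"
begin

lemma V_closed [simp]: "0 \<in> V" "x \<in> V \<Longrightarrow> y \<in> V \<Longrightarrow> x + y \<in> V"
  using V by (auto simp: f2_subspace_iff)

lemma five_form_subspace: "f2_subspace W \<Longrightarrow> W \<subseteq> V \<Longrightarrow> five_form W \<alpha> m"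
  using V \<alpha> sym m by unfold_locales
    (auto intro: multilinear_form_mono symmetric_in_mono finite_subset)

lemma permute: "\<pi> permutes {1..m} \<Longrightarrow> x \<in> {1..5} \<rightarrow>\<^sub>E V \<Longrightarrow> \<alpha> (x \<circ> \<pi>) = \<alpha> x"
  using sym by (simp add: symmetric_in_def)

lemma add_pair:
  assumes "p \<in> {1..m}" "q \<in> {1..m}" "p \<noteq> q" "x \<in> {1..5} \<rightarrow>\<^sub>E V" "u \<in> V" "v \<in> V"
  shows "\<alpha> (x(p := u + v, q := u + v)) = \<alpha> (x(p := u, q := u)) + \<alpha> (x(p := v, q := v))"
  using assms m by (intro additive_on_pair [OF V(1) \<alpha>] permute permutes_swap_id) auto

lemma dup_in: "\<lbrakk>d \<in> V; z \<in> V; c \<in> V\<rbrakk> \<Longrightarrow> dup d z c \<in> {1..5} \<rightarrow>\<^sub>E V"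
  by (auto simp: dup_def)

text \<open>Additivity in \<open>d\<close> is that of the diagonal in positions 1 and 2. The
  permutation (1 3)(2 4), available for \<open>4 \<le> m\<close>, exchanges \<open>d\<close> and
  \<open>z\<close>.\<close>

lemma sym_trilinear_dup:
  assumes "4 \<le> m"
  shows "sym_trilinear V (\<lambda>d z c. \<alpha> (dup d z c))"
proof
  fix x x' z y assume *: "x \<in> V" "x' \<in> V" "z \<in> V" "y \<in> V"
  have eq: "dup w z y = (dup x z y)(1 := w, 2 := w)" for w
    by (auto simp: dup_def fun_eq_iff)
  have "\<alpha> ((dup x z y)(1 := x + x', 2 := x + x')) =
    \<alpha> ((dup x z y)(1 := x, 2 := x)) + \<alpha> ((dup x z y)(1 := x', 2 := x'))"
    using * assms by (intro add_pair dup_in) auto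
  then show "\<alpha> (dup (x + x') z y) = \<alpha> (dup x z y) + \<alpha> (dup x' z y)"
    by (simp only: eq [symmetric])
next
  fix x z y y' assume *: "x \<in> V" "z \<in> V" "y \<in> V" "y' \<in> V"
  have eq: "dup x z w = (dup x z y)(5 := w)" for w
    by (auto simp: dup_def fun_eq_iff)
  have "\<alpha> ((dup x z y)(5 := y + y')) = \<alpha> ((dup x z y)(5 := y)) + \<alpha> ((dup x z y)(5 := y'))"
    using * by (intro multilinear_form_add [OF \<alpha>] dup_in) auto
  then show "\<alpha> (dup x z (y + y')) = \<alpha> (dup x z y) + \<alpha> (dup x z y')"
    by (simp only: eq [symmetric])
next
  fix x z y assume *: "x \<in> V" "z \<in> V" "y \<in> V"
  let ?\<pi> = "transpose 1 3 \<circ> transpose 2 (4::nat)"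
  have "dup z x y \<circ> ?\<pi> = dup x z y"
    by (auto simp: dup_def fun_eq_iff transpose_def)
  moreover have "?\<pi> permutes {1..m}"
    using assms by (intro permutes_compose permutes_swap_id) auto
  ultimately show "\<alpha> (dup x z y) = \<alpha> (dup z x y)"
    using permute dup_in * by metis
qed (use V in auto)

lemma multilinear_diag: "multilinear_form V {1..4} (diag12 5 \<alpha>)"
  unfolding multilinear_form_iff [OF V_closed(1)]
proof (intro ballI)
  fix x :: "nat \<Rightarrow> f2vec" and j u v
  assume *: "x \<in> {1..4} \<rightarrow>\<^sub>E V" "j \<in> {1..4::nat}" "u \<in> V" "v \<in> V"
  define z where "z = (\<lambda>i\<in>{1..5::nat}. if i = 1 then x 1 else x (i - 1))"
  have z: "z \<in> {1..5} \<rightarrow>\<^sub>E V"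
  proof -
    have "x (i - 1) \<in> V" if "i \<in> {1..5}" "i \<noteq> 1" for i
      using that by (intro PiE_mem [OF *(1)]) auto
    moreover have "x 1 \<in> V"
      by (intro PiE_mem [OF *(1)]) auto
    ultimately show ?thesis
      by (auto simp: z_def)
  qed
  \<comment> \<open>Variable 1 fills positions 1 and 2 of \<open>\<alpha>\<close>, where symmetry is
    needed; any other \<open>j\<close> fills position \<open>j + 1\<close> only.\<close>
  show "diag12 5 \<alpha> (x(j := u + v)) = diag12 5 \<alpha> (x(j := u)) + diag12 5 \<alpha> (x(j := v))"
  proof (cases "j = 1")
    case True
    have eq: "diag12 5 \<alpha> (x(j := w)) = \<alpha> (z(1 := w, 2 := w))" for w
      unfolding diag12_def by (rule arg_cong [of _ _ \<alpha>]) (auto simp: True z_def fun_eq_iff)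
    show ?thesis
      unfolding eq using * z m by (intro add_pair) auto
  next
    case False
    have eq: "diag12 5 \<alpha> (x(j := w)) = \<alpha> (z(j + 1 := w))" for w
      unfolding diag12_def using False *(2)
      by (intro arg_cong [of _ _ \<alpha>]) (auto simp: z_def fun_eq_iff)
    show ?thesis
      unfolding eq using * z by (intro multilinear_form_add [OF \<alpha>]) auto
  qed
qed

definition tup :: "f2vec \<Rightarrow> f2vec \<Rightarrow> f2vec \<Rightarrow> nat \<Rightarrow> f2vec" where
  "tup d z c = (\<lambda>j\<in>{1..4}. if j = 1 then d else if j \<le> 3 then z else c)"

lemma diag_tup: "diag12 5 \<alpha> (tup d z c) = \<alpha> (dup d z c)"
  unfolding diag12_def by (rule arg_cong [of _ _ \<alpha>]) (auto simp: dup_def tup_def fun_eq_iff)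

text \<open>
  Among the terms of a decomposition of \<open>\<alpha>(d, d, z, w, c)\<close> into pairs of variables, those which
  do not separate \<open>d\<close> from \<open>c\<close> have a factor depending on \<open>z\<close> only once \<open>w = z\<close>; the
  classes of \<open>q\<close> fix the values of these factors, so these terms cancel in the sum over two
  elements of a class.
\<close>

lemma ex_vanishing_subspace:
  assumes m4: "4 \<le> m" and dec: "has_partition_decomposition V {1..4} (diag12 5 \<alpha>) r"
  shows "\<exists>U. f2_subspace U \<and> U \<subseteq> V \<and>
    card V \<le> 2 ^ (2 * r + (4 * r + 1) * (2 ^ r * (2 * r + 1))) * card U \<and>
    (\<forall>d\<in>U. \<forall>z\<in>U. \<forall>c\<in>U. \<alpha> (dup d z c) = 0)"
proof -
  obtain W S \<beta> \<gamma> where W: "f2_subspace W" "W \<subseteq> V" "card V \<le> 2 ^ r * card W"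
    and S: "\<forall>i<r. 1 \<in> S i \<and> S i \<subset> {1..4}"
    and D: "\<forall>x \<in> {1..4} \<rightarrow>\<^sub>E V.
      diag12 5 \<alpha> x = (\<Sum>i<r. \<beta> i (restrict x (S i)) * \<gamma> i (restrict x ({1..4} - S i)))"
    and kill: "\<forall>i<r. \<forall>x \<in> {1..4} \<rightarrow>\<^sub>E W. card (S i) = 1 \<or> card ({1..4} - S i) = 1 \<longrightarrow>
      \<beta> i (restrict x (S i)) * \<gamma> i (restrict x ({1..4} - S i)) = 0"
    using kill_single_variable_factors [OF V dec, of 1] by auto
  interpret W: five_form W \<alpha> m
    using W by (intro five_form_subspace)
  interpret W: sym_trilinear W "\<lambda>d z c. \<alpha> (dup d z c)"
    using m4 by (rule W.sym_trilinear_dup)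
  define f where "f i x z c = \<beta> i (restrict (tup x z c) (S i)) * \<gamma> i (restrict (tup x z c) ({1..4} - S i))"
    for i x z c
  have tupW: "tup x z c \<in> {1..4} \<rightarrow>\<^sub>E W" if "x \<in> W" "z \<in> W" "c \<in> W" for x z c
    using that by (auto simp: tup_def)
  have T: "\<alpha> (dup x z c) = (\<Sum>i<r. f i x z c)" if "x \<in> W" "z \<in> W" "c \<in> W" for x z c
  proof -
    have "tup x z c \<in> {1..4} \<rightarrow>\<^sub>E V"
      using tupW [OF that] W(2) by (auto simp: PiE_iff)
    then show ?thesis
      using D unfolding diag_tup [symmetric] f_def by blast
  qed
  define q where "q z = {i. i < r \<and> \<gamma> i (restrict (\<lambda>_. z) ({1..4} - S i)) = 1}" for z
  have low: "z + z' \<in> W.low (2 ^ r * 2 ^ r)" if z: "z \<in> W" "z' \<in> W" and qz: "q z = q z'" for z z'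
  proof -
    \<comment> \<open>Only terms with \<open>4 \<notin> S i\<close> use these values, so position 4
      holds the dummy \<open>w\<close>. The pair \<open>\<phi> x\<close> then takes at most
      \<open>2 ^ r * 2 ^ r\<close> values, which is the bound on the number of slices.\<close>
    define p where "p w x = {i. i < r \<and> \<beta> i (restrict (tup x w w) (S i)) = 1}" for w x
    define \<phi> where "\<phi> x = (p z x, p z' x)" for x
    have cancel: "f i x z c + f i x z' c = f i x' z c + f i x' z' c"
      if i: "i < r" and x: "x \<in> W" "x' \<in> W" and c: "c \<in> W" and eq: "\<phi> x = \<phi> x'" for i x x' c
    proof -
      \<comment> \<open>If 1 and 4 lie in \<open>S i\<close>, its complement is a non-empty subset
        of \<open>{2, 3}\<close>: a singleton or the whole pair.\<close>
      consider "card (S i) = 1 \<or> card ({1..4} - S i) = 1" | "4 \<notin> S i" | "S i = {1, 4}"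
      proof -
        have "\<not> (2 \<in> S i \<and> 3 \<in> S i)" if "4 \<in> S i"
          using S i that unfolding upto_4 by auto
        moreover have "{1..4} - S i = {3}" if "4 \<in> S i" "2 \<in> S i" "3 \<notin> S i"
          using S i that unfolding upto_4 by auto
        moreover have "{1..4} - S i = {2}" if "4 \<in> S i" "3 \<in> S i" "2 \<notin> S i"
          using S i that unfolding upto_4 by auto
        moreover have "S i = {1, 4}" if "4 \<in> S i" "3 \<notin> S i" "2 \<notin> S i"
          using S i that unfolding upto_4 by auto
        ultimately show ?thesis
          using that by (cases "4 \<in> S i"; cases "2 \<in> S i"; cases "3 \<in> S i") auto
      qed
      then show ?thesis
      proof cases
        case 1
        then have "f i y w c = 0" if "y \<in> W" "w \<in> W" for y w
          using kill i tupW that c unfolding f_def by blast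
        then show ?thesis
          using x z by simp
      next
        \<comment> \<open>The second factor does not see \<open>x\<close>, since
          \<open>1 \<in> S i\<close>; the first does not see \<open>c\<close> and is fixed by
          \<open>\<phi>\<close>.\<close>
        case 2
        have 1: "1 \<in> S i"
          using S i by simp
        have \<beta>: "\<beta> i (restrict (tup y w c) (S i)) = \<beta> i (restrict (tup y w w) (S i))" for y w
        proof (rule arg_cong [of _ _ "\<beta> i"])
          have "tup y w c j = tup y w w j" if "j \<in> S i" for j
          proof -
            have "j \<noteq> 4"
              using that 2 by auto
            then show ?thesis
              by (auto simp: tup_def)
          qed
          then show "restrict (tup y w c) (S i) = restrict (tup y w w) (S i)"
            by (auto simp: fun_eq_iff)
        qed
        have \<gamma>: "\<gamma> i (restrict (tup x w c) ({1..4} - S i)) = \<gamma> i (restrict (tup x' w c) ({1..4} - S i))" for w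
        proof (rule arg_cong [of _ _ "\<gamma> i"])
          have "tup x w c j = tup x' w c j" if "j \<notin> S i" for j
          proof -
            have "j \<noteq> 1"
              using that 1 by auto
            then show ?thesis
              by (auto simp: tup_def)
          qed
          then show "restrict (tup x w c) ({1..4} - S i) = restrict (tup x' w c) ({1..4} - S i)"
            by (auto simp: fun_eq_iff)
        qed
        have "\<beta> i (restrict (tup x w w) (S i)) = \<beta> i (restrict (tup x' w w) (S i))"
          if "w = z \<or> w = z'" for w
        proof -
          have "p w x = p w x'"
            using that eq by (auto simp: \<phi>_def)
          then have "\<beta> i (restrict (tup x w w) (S i)) = 1 \<longleftrightarrow> \<beta> i (restrict (tup x' w w) (S i)) = 1"
            using i unfolding p_def by blast
          then show ?thesis
            by (rule bit_eq_of_eq_1_iff)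
        qed
        then show ?thesis
          unfolding f_def \<beta> \<gamma> by simp
      next
        \<comment> \<open>The first factor does not see the middle argument, and the second agrees
          at \<open>z\<close> and \<open>z'\<close> by \<open>qz\<close>. Each side is a sum of two
          equal terms.\<close>
        case 3
        have \<gamma>: "\<gamma> i (restrict (tup y w c) ({1..4} - S i)) = \<gamma> i (restrict (\<lambda>_. w) ({1..4} - S i))" for y w
          unfolding 3 by (rule arg_cong [of _ _ "\<gamma> i"]) (auto simp: tup_def fun_eq_iff)
        have "\<gamma> i (restrict (\<lambda>_. z) ({1..4} - S i)) = 1 \<longleftrightarrow> \<gamma> i (restrict (\<lambda>_. z') ({1..4} - S i)) = 1"
          using qz i unfolding q_def by blast
        then have \<gamma>z: "\<gamma> i (restrict (\<lambda>_. z) ({1..4} - S i)) = \<gamma> i (restrict (\<lambda>_. z') ({1..4} - S i))"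
          by (rule bit_eq_of_eq_1_iff)
        have \<beta>: "\<beta> i (restrict (tup y z c) (S i)) = \<beta> i (restrict (tup y z' c) (S i))" for y
          unfolding 3 by (rule arg_cong [of _ _ "\<beta> i"]) (auto simp: tup_def fun_eq_iff)
        show ?thesis
          unfolding f_def \<gamma> \<beta> \<gamma>z by (simp only: bit_add_eq_0_iff [THEN iffD2])
      qed
    qed
    have sl: "W.slice (z + z') x = W.slice (z + z') x'"
      if x: "x \<in> W" "x' \<in> W" and eq: "\<phi> x = \<phi> x'" for x x'
    proof -
      have "\<alpha> (dup x (z + z') c) = \<alpha> (dup x' (z + z') c)" if c: "c \<in> W" for c
      proof -
        have "\<alpha> (dup y (z + z') c) = (\<Sum>i<r. f i y z c + f i y z' c)" if "y \<in> W" for y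
          using that z c by (simp only: W.add2 T sum.distrib)
        then show ?thesis
          using x cancel [OF _ x c eq] by (simp only:) (intro sum.cong refl; simp only: lessThan_iff)
      qed
      then show ?thesis
        unfolding W.slice_def by (auto simp: fun_eq_iff restrict_def)
    qed
    have "card (W.slice (z + z') ` W) \<le> card (\<phi> ` W)"
      by (rule card_image_factor [OF W.V(2) sl])
    also have "\<dots> \<le> card (Pow {..<r} \<times> Pow {..<r})"
      by (intro card_mono) (auto simp: \<phi>_def p_def)
    also have "\<dots> = 2 ^ r * 2 ^ r"
      by (simp add: card_cartesian_product card_Pow)
    finally show ?thesis
      using z by (simp add: W.low_def)
  qed
  have small: "(2::nat) ^ r * 2 ^ r < 2 ^ (2 * r + 1)"
    by (simp add: power_add mult_2)
  have fin: "finite (Pow {..<r})" and q: "q ` W \<subseteq> Pow {..<r}" and pos: "0 < (2::nat) ^ r * 2 ^ r"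
    by (auto simp: q_def)
  obtain U where U: "f2_subspace U" "U \<subseteq> W"
      "card W \<le> (2 * (2 ^ r * 2 ^ r) * (2 ^ r * 2 ^ r)) ^ (card (Pow {..<r}) * (2 * r + 1)) *
        card (Pow {..<r}) * card U"
      "\<forall>d\<in>U. \<forall>z\<in>U. \<forall>c\<in>U. \<alpha> (dup d z c) = 0"
    using W.vanish_on_large_subspace [OF fin q low small pos] by blast
  \<comment> \<open>Each triple costs \<open>4 * r + 1\<close> in the exponent, and there are at
    most \<open>2 ^ r * (2 * r + 1)\<close> triples. The final span costs another \<open>r\<close>,
    and so does the passage to \<open>W\<close>.\<close>
  have "2 * (2 ^ r * 2 ^ r) * (2 ^ r * 2 ^ r) = (2::nat) ^ (4 * r + 1)"
    by (simp add: power_add [symmetric])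
  then have "card W \<le> 2 ^ ((4 * r + 1) * (2 ^ r * (2 * r + 1)) + r) * card U"
    using U(3) by (simp only: card_Pow finite_lessThan card_lessThan power_mult power_add)
  then have "2 ^ r * card W \<le> 2 ^ r * (2 ^ ((4 * r + 1) * (2 ^ r * (2 * r + 1)) + r) * card U)"
    by (rule mult_le_mono2)
  also have "\<dots> = 2 ^ (r + ((4 * r + 1) * (2 ^ r * (2 * r + 1)) + r)) * card U"
    by (simp only: power_add mult.assoc)
  also have "r + ((4 * r + 1) * (2 ^ r * (2 * r + 1)) + r) = 2 * r + (4 * r + 1) * (2 ^ r * (2 * r + 1))"
    by simp
  finally have "card V \<le> 2 ^ (2 * r + (4 * r + 1) * (2 ^ r * (2 * r + 1))) * card U"
    using W(3) by (rule order_trans [rotated])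
  then show ?thesis
    using U W by blast
qed

end

section \<open>The symmetric correction\<close>

definition pairs :: "nat set \<Rightarrow> nat set set" where
  "pairs A = {e. e \<subseteq> A \<and> card e = 2}"

lemma finite_pairs: "finite A \<Longrightarrow> finite (pairs A)"
  by (simp add: pairs_def)

lemma card_pairs: "finite A \<Longrightarrow> card (pairs A) = card A choose 2"
  by (simp add: pairs_def n_subsets)

lemma finite_pair: "e \<in> pairs A \<Longrightarrow> finite e"
  by (auto simp: pairs_def intro: card_ge_0_finite)

text \<open>The condition \<open>vanish\<close> is guarded because two disjoint pairs of symmetric
  variables exist only for \<open>4 \<le> m\<close>.\<close>

locale correction = five_form V \<alpha> m + f2_basis U B
  for V :: "f2vec set" and \<alpha> :: form and m :: nat and U B :: "f2vec set" +
  assumes UV: "U \<subseteq> V"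
    and vanish: "\<And>d z c. \<lbrakk>4 \<le> m; d \<in> U; z \<in> U; c \<in> U\<rbrakk> \<Longrightarrow> \<alpha> (dup d z c) = 0"
begin

definition fold :: "nat set \<Rightarrow> (nat \<Rightarrow> f2vec) \<Rightarrow> nat \<Rightarrow> f2vec" where
  "fold e x = (\<lambda>i\<in>{1..5}. if i \<in> e then meet e x else x i)"

text \<open>
  The form \<open>\<phi>\<close>: by the symmetry of \<open>\<alpha>\<close>, the summand \<open>D(x\<^sub>p \<circ> x\<^sub>q, \<dots>)\<close> is the value of \<open>\<alpha>\<close> after
  both \<open>x\<^sub>p\<close> and \<open>x\<^sub>q\<close> are replaced by \<open>x\<^sub>p \<circ> x\<^sub>q\<close> in place, so no variables need reordering.
\<close>

definition corr :: form where
  "corr x = (\<Sum>e\<in>pairs {1..m}. \<alpha> (fold e x))"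

lemma fam_UV: "x \<in> {1..5::nat} \<rightarrow>\<^sub>E U \<Longrightarrow> x \<in> {1..5} \<rightarrow>\<^sub>E V"
  using UV PiE_mono [of "{1..5::nat}" "\<lambda>_. U" "\<lambda>_. V"] by blast

lemma fold_in: "x \<in> {1..5} \<rightarrow>\<^sub>E U \<Longrightarrow> fold e x \<in> {1..5} \<rightarrow>\<^sub>E U"
  by (auto simp: fold_def meet_in)

lemma perm_range: "\<pi> permutes {1..m} \<Longrightarrow> \<pi> permutes {1..5}"
  using m by (auto intro: permutes_subset)

text \<open>Replacement in place commutes with permuting the variables, up to a permutation that
  \<open>\<alpha>\<close> absorbs. So permuting the variables of \<open>corr\<close> only permutes
  its summands.\<close>

lemma fold_permute:
  assumes \<pi>: "\<pi> permutes {1..m}" and x: "x \<in> {1..5} \<rightarrow>\<^sub>E U"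
  shows "\<alpha> (fold e (x \<circ> \<pi>)) = \<alpha> (fold (\<pi> ` e) x)"
proof -
  have inj: "inj \<pi>"
    using \<pi> permutes_inj by blast
  have "fold e (x \<circ> \<pi>) = fold (\<pi> ` e) x \<circ> \<pi>"
  proof
    fix i
    have "\<pi> i \<in> {1..5} \<longleftrightarrow> i \<in> {1..5}"
      using permutes_in_image [OF perm_range [OF \<pi>]] .
    moreover have "meet e (x \<circ> \<pi>) = meet (\<pi> ` e) x"
      using inj by (intro meet_image) (auto intro: inj_on_subset)
    ultimately show "fold e (x \<circ> \<pi>) i = (fold (\<pi> ` e) x \<circ> \<pi>) i"
      using inj by (simp add: fold_def inj_image_mem_iff)
  qed
  then show ?thesis
    using permute [OF \<pi>] fam_UV fold_in x by simp
qed

lemma image_pairs: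
  assumes "\<pi> permutes A" "e \<in> pairs A"
  shows "\<pi> ` e \<in> pairs A"
proof -
  have "card (\<pi> ` e) = card e"
    using permutes_inj [OF assms(1)] by (intro card_image) (auto intro: inj_on_subset)
  then show ?thesis
    using assms permutes_image [OF assms(1)] by (auto simp: pairs_def)
qed

lemma symmetric_corr: "symmetric_in U {1..5} {1..m} corr"
  unfolding symmetric_in_def
proof (intro allI impI ballI)
  fix \<pi> and x :: "nat \<Rightarrow> f2vec" assume \<pi>: "\<pi> permutes {1..m}" and x: "x \<in> {1..5} \<rightarrow>\<^sub>E U"
  have "corr (x \<circ> \<pi>) = (\<Sum>e\<in>pairs {1..m}. \<alpha> (fold (\<pi> ` e) x))"
    unfolding corr_def by (intro sum.cong refl fold_permute \<pi> x)
  also have "\<dots> = corr x"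
    unfolding corr_def
  proof (rule sum.reindex_bij_witness [where i = "\<lambda>e. inv \<pi> ` e" and j = "\<lambda>e. \<pi> ` e"])
    fix e assume e: "e \<in> pairs {1..m}"
    show "inv \<pi> ` \<pi> ` e = e" "\<pi> ` inv \<pi> ` e = e"
      using \<pi> by (simp_all add: image_image permutes_inverses)
    show "\<pi> ` e \<in> pairs {1..m}" "inv \<pi> ` e \<in> pairs {1..m}"
      using e \<pi> permutes_inv by (auto intro!: image_pairs)
  qed simp
  finally show "corr (x \<circ> \<pi>) = corr x" .
qed

text \<open>A permutation fixing 1 and 2 moves the pair \<open>e\<close> to positions 3 and 4. The
  argument then has the form \<open>dup d z c\<close>, where \<open>\<alpha>\<close>
  vanishes.\<close>

lemma fold_disjoint_zero:
  assumes e: "e \<in> pairs {3..m}" and x: "x \<in> {1..5} \<rightarrow>\<^sub>E U" and eq: "x 1 = x 2"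
  shows "\<alpha> (fold e x) = 0"
proof -
  obtain p q where pq: "e = {p, q}" "p \<noteq> q" "p \<in> {3..m}" "q \<in> {3..m}"
    using e by (auto simp: pairs_def card_2_iff)
  then have m4: "4 \<le> m"
    by auto
  obtain \<pi> where \<pi>: "\<pi> permutes {3..m}" "\<pi> 3 = p" "\<pi> 4 = q"
    using ex_permutes_pair [of 3 "{3..m}" 4 p q] pq m4 by auto
  have \<pi>m: "\<pi> permutes {1..m}"
    using \<pi>(1) by (rule permutes_subset) auto
  have fix12: "\<pi> 1 = 1" "\<pi> 2 = 2"
    using \<pi>(1) by (auto simp: permutes_def)
  have in5: "\<pi> i \<in> {1..5} \<longleftrightarrow> i \<in> {1..5}" for i
    using permutes_in_image [OF perm_range [OF \<pi>m]] .
  have "fold e x \<circ> \<pi> = dup (x 1) (meet e x) (fold e x (\<pi> 5))"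
  proof
    fix i
    show "(fold e x \<circ> \<pi>) i = dup (x 1) (meet e x) (fold e x (\<pi> 5)) i"
    proof (cases "i \<in> {1..5}")
      case True
      then consider "i = 1" | "i = 2" | "i = 3" | "i = 4" | "i = 5"
        by fastforce
      then show ?thesis
        using fix12 \<pi> pq eq m by cases (auto simp: dup_def fold_def)
    next
      case False
      then show ?thesis
        using in5 [of i] by (auto simp: dup_def fold_def)
    qed
  qed
  moreover have "fold e x (\<pi> 5) \<in> U"
    using fold_in [OF x] in5 [of 5] by (auto simp: PiE_iff)
  moreover have "x 1 \<in> U"
    using x by (auto simp: PiE_iff)
  ultimately have "\<alpha> (fold e x \<circ> \<pi>) = 0"
    using vanish [OF m4] meet_in by simp
  then show ?thesis
    using permute [OF \<pi>m fam_UV [OF fold_in [OF x]]] by simp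
qed

text \<open>The swap of 1 and 2 fixes \<open>x\<close>, so it matches the pairs containing only 1
  with those containing only 2, and their summands cancel. The pair \<open>{1, 2}\<close> leaves
  \<open>x\<close> unchanged, and pairs avoiding both contribute 0.\<close>

lemma corr_diagonal:
  assumes x: "x \<in> {1..5} \<rightarrow>\<^sub>E U" and eq: "x 1 = x 2"
  shows "corr x = \<alpha> x"
proof -
  define g where "g e = \<alpha> (fold e x)" for e
  let ?\<tau> = "transpose 1 (2::nat)"
  have \<tau>: "?\<tau> permutes {1..m}"
    using m by (intro permutes_swap_id) auto
  have "x \<circ> ?\<tau> = x"
    using eq by (auto simp: fun_eq_iff transpose_def)
  then have g\<tau>: "g (?\<tau> ` e) = g e" for e
    using fold_permute [OF \<tau> x, of e] by (simp add: g_def)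
  define P where "P = pairs {1..m}"
  define P1 where "P1 = {e\<in>P. 1 \<in> e \<and> 2 \<notin> e}"
  define P2 where "P2 = {e\<in>P. 1 \<notin> e \<and> 2 \<in> e}"
  define P0 where "P0 = {e\<in>P. 1 \<notin> e \<and> 2 \<notin> e}"
  have fin: "finite P"
    by (simp add: P_def finite_pairs)
  have both: "e = {1, 2}" if "e \<in> P" "1 \<in> e" "2 \<in> e" for e
  proof -
    have "finite e"
      using that(1) unfolding P_def by (rule finite_pair)
    moreover have "card e = 2"
      using that(1) by (simp add: P_def pairs_def)
    ultimately show ?thesis
      using that card_subset_eq [of e "{1, 2}"] by auto
  qed
  have "{1, 2} \<in> P"
    using m by (auto simp: P_def pairs_def)
  then have split: "P = {{1, 2}} \<union> (P1 \<union> (P2 \<union> P0))"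
  proof (intro equalityI subsetI)
    fix e assume "e \<in> P"
    then show "e \<in> {{1, 2}} \<union> (P1 \<union> (P2 \<union> P0))"
      using both [of e] by (simp add: P1_def P2_def P0_def) blast
  next
    fix e assume "e \<in> {{1, 2}} \<union> (P1 \<union> (P2 \<union> P0))"
    then show "e \<in> P"
      using \<open>{1, 2} \<in> P\<close> by (auto simp: P1_def P2_def P0_def)
  qed
  have "corr x = (\<Sum>e\<in>{{1, 2}} \<union> (P1 \<union> (P2 \<union> P0)). g e)"
    unfolding split [symmetric] by (simp add: corr_def P_def g_def)
  also have "\<dots> = g {1, 2} + (sum g P1 + (sum g P2 + sum g P0))"
  proof -
    have f: "finite P1" "finite P2" "finite P0"
      using fin by (auto simp: P1_def P2_def P0_def)
    have d: "P2 \<inter> P0 = {}" "P1 \<inter> (P2 \<union> P0) = {}" "{{1, 2}} \<inter> (P1 \<union> (P2 \<union> P0)) = {}"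
      by (auto simp: P1_def P2_def P0_def)
    show ?thesis
      using f d(1,2) by (subst sum.union_disjoint [OF _ _ d(3)]) (auto simp: sum.union_disjoint)
  qed
  also have "sum g P1 = sum g P2"
  proof (rule sum.reindex_bij_witness [where i = "\<lambda>e. ?\<tau> ` e" and j = "\<lambda>e. ?\<tau> ` e"])
    have mem: "1 \<in> ?\<tau> ` e \<longleftrightarrow> 2 \<in> e" "2 \<in> ?\<tau> ` e \<longleftrightarrow> 1 \<in> e" for e
      using inj_image_mem_iff [OF inj_transpose, of 1 2 2 e] inj_image_mem_iff [OF inj_transpose, of 1 2 1 e]
      by simp_all
    fix e
    show "?\<tau> ` ?\<tau> ` e = e" "?\<tau> ` ?\<tau> ` e = e"
      by (simp_all add: image_image)
    show "?\<tau> ` e \<in> P2" if "e \<in> P1"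
      using that image_pairs [OF \<tau>] mem by (auto simp: P1_def P2_def P_def)
    show "?\<tau> ` e \<in> P1" if "e \<in> P2"
      using that image_pairs [OF \<tau>] mem by (auto simp: P1_def P2_def P_def)
    show "g (?\<tau> ` e) = g e"
      by (rule g\<tau>)
  qed
  also have "sum g P0 = 0"
  proof (rule sum.neutral, rule ballI)
    fix e assume "e \<in> P0"
    then have e: "e \<subseteq> {1..m}" "card e = 2" "1 \<notin> e" "2 \<notin> e"
      by (auto simp: P0_def P_def pairs_def)
    have "e \<subseteq> {3..m}"
    proof
      fix i assume i: "i \<in> e"
      then have "i \<noteq> 1" "i \<noteq> 2" "i \<in> {1..m}"
        using e by auto
      then show "i \<in> {3..m}"
        by auto
    qed
    then show "g e = 0"
      using e(2) fold_disjoint_zero [OF _ x eq] by (auto simp: g_def pairs_def)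
  qed
  also have "g {1, 2} = \<alpha> x"
  proof -
    have "x 1 \<in> U"
      using x by (auto simp: PiE_iff)
    then have "meet {1, 2} x = x 1"
      using eq by (intro meet_const) auto
    then have "fold {1, 2} x = x"
      using x eq by (auto simp: fold_def fun_eq_iff PiE_iff extensional_def)
    then show ?thesis
      by (simp add: g_def)
  qed
  finally show ?thesis
    by simp
qed

text \<open>Each summand of \<open>corr\<close> is the diagonal after a substitution: variable 1
  receives the product over \<open>e\<close>, the others receive the three variables outside
  \<open>e\<close>. Multilinearity and partition rank bounds are thereby inherited from the
  diagonal.\<close>

lemma fold_eq_diag:
  assumes e: "e \<in> pairs {1..m}"
  shows "\<exists>\<sigma> Y. family_subst U V {1..4} {1..5} \<sigma> Y \<and>
    (\<forall>x \<in> {1..5} \<rightarrow>\<^sub>E U. diag12 5 \<alpha> (restrict (Y x) {1..4}) = \<alpha> (fold e x))"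
proof -
  obtain p q where pq: "e = {p, q}" "p \<noteq> q" "p \<in> {1..m}" "q \<in> {1..m}"
    using e by (auto simp: pairs_def card_2_iff)
  obtain \<pi> where \<pi>: "\<pi> permutes {1..m}" "\<pi> 1 = p" "\<pi> 2 = q"
    using ex_permutes_pair [of 1 "{1..m}" 2 p q] pq m by auto
  have in5: "\<pi> i \<in> {1..5} \<longleftrightarrow> i \<in> {1..5}" for i
    using permutes_in_image [OF perm_range [OF \<pi>(1)]] .
  have ine: "\<pi> i \<in> e \<longleftrightarrow> i = 1 \<or> i = 2" for i
    using permutes_inj [OF \<pi>(1)] \<pi>(2,3) by (auto simp: pq(1) inj_eq)
  have e5: "e \<subseteq> {1..5}"
    using pq m by auto
  \<comment> \<open>Both indices of \<open>e\<close> feed variable 1. The shift by one reflects that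
    variable \<open>j\<close> of the diagonal is position \<open>j + 1\<close> of
    \<open>\<alpha>\<close> for \<open>j > 1\<close>.\<close>
  define \<sigma> where "\<sigma> l = (if l \<in> e then 1 else inv \<pi> l - 1)" for l
  define Y where "Y x j = (if j = 1 then meet e x else x (\<pi> (j + 1)))" for x j
  have \<sigma>_not_in: "\<sigma> l \<in> {2..4} \<and> \<pi> (\<sigma> l + 1) = l" if "l \<in> {1..5}" "l \<notin> e" for l
  proof -
    have "\<pi> (inv \<pi> l) = l"
      by (rule permutes_inverses(1) [OF \<pi>(1)])
    then have "inv \<pi> l \<in> {1..5}" "inv \<pi> l \<noteq> 1" "inv \<pi> l \<noteq> 2"
      using in5 ine that by metis+
    then show ?thesis
      using \<open>\<pi> (inv \<pi> l) = l\<close> that by (auto simp: \<sigma>_def)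
  qed
  have \<pi>_in: "\<pi> (j + 1) \<in> {1..5} \<and> \<pi> (j + 1) \<notin> e \<and> \<sigma> (\<pi> (j + 1)) = j"
    if "j \<in> {1..4}" "j \<noteq> 1" for j
  proof -
    have "\<pi> (j + 1) \<notin> e"
      using ine that by auto
    moreover have "inv \<pi> (\<pi> (j + 1)) = j + 1"
      by (rule permutes_inverses(2) [OF \<pi>(1)])
    moreover have "\<pi> (j + 1) \<in> {1..5}"
      using in5 that by auto
    ultimately show ?thesis
      by (simp add: \<sigma>_def)
  qed
  have fin: "finite e"
    using e finite_pair by blast
  have "family_subst U V {1..4} {1..5} \<sigma> Y"
  proof
    show "f2_subspace U" "f2_subspace V"
      by (fact U V)+
    show "\<sigma> ` {1..5} = {1..4}"
    proof
      show "\<sigma> ` {1..5} \<subseteq> {1..4}"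
      proof
        fix j assume "j \<in> \<sigma> ` {1..5}"
        then obtain l where l: "l \<in> {1..5}" "j = \<sigma> l"
          by blast
        then show "j \<in> {1..4}"
          using \<sigma>_not_in [of l] by (cases "l \<in> e") (auto simp: \<sigma>_def)
      qed
      show "{1..4} \<subseteq> \<sigma> ` {1..5}"
      proof
        fix j :: nat assume j: "j \<in> {1..4}"
        have "\<sigma> p = 1" "p \<in> {1..5}"
          using pq e5 by (auto simp: \<sigma>_def)
        then show "j \<in> \<sigma> ` {1..5}"
          using \<pi>_in [OF j] by (cases "j = 1") (auto intro: rev_image_eqI)
      qed
    qed
  next
    fix x :: "nat \<Rightarrow> f2vec" and j
    assume "j \<in> {1..4::nat}" "\<And>l. l \<in> {1..5} \<Longrightarrow> \<sigma> l = j \<Longrightarrow> x l \<in> U"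
    then have "Y x j \<in> U"
      using \<pi>_in [of j] meet_in by (auto simp: Y_def)
    then show "Y x j \<in> V"
      using UV by blast
  next
    fix x x' :: "nat \<Rightarrow> f2vec" and j
    assume j: "j \<in> {1..4::nat}" and eq: "\<And>l. l \<in> {1..5} \<Longrightarrow> \<sigma> l = j \<Longrightarrow> x l = x' l"
    show "Y x j = Y x' j"
    proof (cases "j = 1")
      case True
      have "meet e x = meet e x'"
        using e5 eq True by (intro meet_cong) (auto simp: \<sigma>_def)
      then show ?thesis
        using True by (simp add: Y_def)
    next
      case False
      then show ?thesis
        using \<pi>_in [OF j] eq by (simp add: Y_def)
    qed
  next
    fix x :: "nat \<Rightarrow> f2vec" and l u v
    assume l: "l \<in> {1..5::nat}" and uv: "u \<in> U" "v \<in> U"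
    show "Y (x(l := u + v)) (\<sigma> l) = Y (x(l := u)) (\<sigma> l) + Y (x(l := v)) (\<sigma> l)"
    proof (cases "l \<in> e")
      case True
      then show ?thesis
        using meet_add [OF fin True uv] by (simp add: Y_def \<sigma>_def)
    next
      case False
      then show ?thesis
        using \<sigma>_not_in [OF l] by (auto simp: Y_def)
    qed
  qed
  moreover have "diag12 5 \<alpha> (restrict (Y x) {1..4}) = \<alpha> (fold e x)"
    if x: "x \<in> {1..5} \<rightarrow>\<^sub>E U" for x
  proof -
    have "\<alpha> (fold e x \<circ> \<pi>) = diag12 5 \<alpha> (restrict (Y x) {1..4})"
      unfolding diag12_def
    proof (rule arg_cong [of _ _ \<alpha>], rule ext)
      fix i :: nat
      consider "i \<notin> {1..5}" | "i = 1" | "i = 2" | "i \<in> {3..5}"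
        by fastforce
      then show "(fold e x \<circ> \<pi>) i =
        (\<lambda>i\<in>{1..5}. if i = 1 then restrict (Y x) {1..4} 1 else restrict (Y x) {1..4} (i - 1)) i"
        using in5 [of i] ine [of i] by cases (auto simp: fold_def Y_def)
    qed
    then show ?thesis
      using permute [OF \<pi>(1) fam_UV [OF fold_in [OF x]]] by simp
  qed
  ultimately show ?thesis
    by blast
qed

lemma multilinear_corr: "multilinear_form U {1..5} corr"
proof -
  have "multilinear_form U {1..5} (\<lambda>x. \<alpha> (fold e x))" if e: "e \<in> pairs {1..m}" for e
  proof -
    obtain \<sigma> Y where Y: "family_subst U V {1..4} {1..5} \<sigma> Y"
      "\<forall>x \<in> {1..5} \<rightarrow>\<^sub>E U. diag12 5 \<alpha> (restrict (Y x) {1..4}) = \<alpha> (fold e x)"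
      using fold_eq_diag [OF e] by blast
    have "multilinear_form U {1..5} (\<lambda>x. diag12 5 \<alpha> (restrict (Y x) {1..4}))"
      using family_subst.multilinear_pullback [OF Y(1) order_refl multilinear_diag]
      by (simp only: family_subst.fibre_all [OF Y(1)])
    then show ?thesis
      using U Y(2) by (elim multilinear_form_cong) (auto simp: f2_subspace_iff)
  qed
  then have "multilinear_form U {1..5} (\<lambda>x. \<Sum>e\<in>pairs {1..m}. \<alpha> (fold e x))"
    by (rule multilinear_form_sum)
  then show ?thesis
    unfolding corr_def [abs_def] .
qed

lemma has_partition_decomposition_corr:
  assumes "has_partition_decomposition V {1..4} (diag12 5 \<alpha>) r"
  shows "has_partition_decomposition U {1..5} corr ((m choose 2) * r)"
proof -
  have "has_partition_decomposition U {1..5} (\<lambda>x. \<alpha> (fold e x)) r" if e: "e \<in> pairs {1..m}" for e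
  proof -
    obtain \<sigma> Y where Y: "family_subst U V {1..4} {1..5} \<sigma> Y"
      "\<forall>x \<in> {1..5} \<rightarrow>\<^sub>E U. diag12 5 \<alpha> (restrict (Y x) {1..4}) = \<alpha> (fold e x)"
      using fold_eq_diag [OF e] by blast
    show ?thesis
      using family_subst.has_partition_decomposition_pullback [OF Y(1) assms]
      by (rule has_partition_decomposition_cong) (use Y(2) in blast)
  qed
  then have "has_partition_decomposition U {1..5} (\<lambda>x. \<Sum>e\<in>pairs {1..m}. \<alpha> (fold e x))
      (card (pairs {1..m}) * r)"
    by (intro has_partition_decomposition_sum finite_pairs) auto
  then show ?thesis
    unfolding corr_def [abs_def] by (simp add: card_pairs)
qed

end

section \<open>Assembling both ranges of arity\<close>

lemma restrict_shift_in:
  fixes k :: nat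
  assumes "2 \<le> k" "y \<in> {1..k - 1} \<rightarrow>\<^sub>E U"
  shows "(\<lambda>i\<in>{1..k}. if i = 1 then y 1 else y (i - 1)) \<in> {1..k} \<rightarrow>\<^sub>E U"
proof -
  have "(if i = 1 then y 1 else y (i - 1)) \<in> U" if "i \<in> {1..k}" for i
    using that assms by (auto intro!: PiE_mem [OF assms(2)])
  then show ?thesis
    by simp
qed

lemma (in five_form) ex_correction:
  assumes dec: "has_partition_decomposition V {1..4} (diag12 5 \<alpha>) r"
  shows "\<exists>U \<alpha>'. f2_subspace U \<and> U \<subseteq> V \<and>
    card V \<le> 2 ^ (2 * r + (4 * r + 1) * (2 ^ r * (2 * r + 1))) * card U \<and>
    multilinear_form U {1..5} \<alpha>' \<and> symmetric_in U {1..5} {1..m} \<alpha>' \<and>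
    (\<forall>y \<in> {1..4} \<rightarrow>\<^sub>E U. diag12 5 \<alpha>' y = 0) \<and>
    has_partition_decomposition U {1..5} (\<lambda>x. \<alpha> x + \<alpha>' x) ((m choose 2) * r)"
proof -
  obtain U where W: "f2_subspace U" "U \<subseteq> V"
      "card V \<le> 2 ^ (2 * r + (4 * r + 1) * (2 ^ r * (2 * r + 1))) * card U"
      "\<And>d z c. \<lbrakk>4 \<le> m; d \<in> U; z \<in> U; c \<in> U\<rbrakk> \<Longrightarrow> \<alpha> (dup d z c) = 0"
  proof (cases "4 \<le> m")
    case True
    then show ?thesis
      using ex_vanishing_subspace [OF _ dec] that by blast
  next
    case False
    then show ?thesis
      using that [of V] V by simp
  qed
  obtain B where B: "B \<subseteq> U" "\<not> f2_dependent B" "U \<subseteq> f2_span B"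
    by (rule f2.basis_exists [of U])
  have "finite B"
    using B(1) W(2) V(2) by (meson finite_subset)
  then interpret correction V \<alpha> m U B
    using W B by unfold_locales auto
  \<comment> \<open>In characteristic 2, \<open>\<alpha> + \<alpha>'\<close> is \<open>corr\<close>,
    while on the diagonal \<open>corr\<close> equals \<open>\<alpha>\<close> and so
    \<open>\<alpha>'\<close> is 0.\<close>
  define \<alpha>' where "\<alpha>' x = \<alpha> x + corr x" for x
  have \<alpha>U: "multilinear_form U {1..5} \<alpha>" "symmetric_in U {1..5} {1..m} \<alpha>"
    using \<alpha> sym UV multilinear_form_mono symmetric_in_mono by blast+
  have "multilinear_form U {1..5} \<alpha>'"
    unfolding \<alpha>'_def [abs_def] by (intro multilinear_form_plus \<alpha>U multilinear_corr)
  moreover have "symmetric_in U {1..5} {1..m} \<alpha>'"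
    using \<alpha>U(2) symmetric_corr by (simp add: symmetric_in_def \<alpha>'_def)
  moreover have "diag12 5 \<alpha>' y = 0" if "y \<in> {1..4} \<rightarrow>\<^sub>E U" for y
  proof -
    have "(\<lambda>i\<in>{1..5::nat}. if i = 1 then y 1 else y (i - 1)) \<in> {1..5} \<rightarrow>\<^sub>E U"
      using that by (intro restrict_shift_in) auto
    from corr_diagonal [OF this] show ?thesis
      by (simp add: diag12_def \<alpha>'_def)
  qed
  moreover have "has_partition_decomposition U {1..5} (\<lambda>x. \<alpha> x + \<alpha>' x) ((m choose 2) * r)"
    using has_partition_decomposition_corr [OF dec]
    by (rule has_partition_decomposition_cong) (simp only: \<alpha>'_def add.assoc [symmetric], simp)
  ultimately show ?thesis
    using W by blast
qed

text \<open>With at most three variables, one side of every partition is a singleton, so all terms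
  die on the common kernel. For \<open>k = 2\<close> there are no terms at all.\<close>

lemma ex_zero_subspace_small_arity:
  assumes V: "f2_subspace V" "finite V" and k: "2 \<le> k" "k \<le> 4"
    and dec: "has_partition_decomposition V {1..k - 1} D r"
  shows "\<exists>W. f2_subspace W \<and> W \<subseteq> V \<and> card V \<le> 2 ^ r * card W \<and>
    (\<forall>x \<in> {1..k - 1} \<rightarrow>\<^sub>E W. D x = 0)"
proof -
  obtain W S \<beta> \<gamma> where W: "f2_subspace W" "W \<subseteq> V" "card V \<le> 2 ^ r * card W"
    and S: "\<forall>i<r. 1 \<in> S i \<and> S i \<subset> {1..k - 1}"
    and D: "\<forall>x \<in> {1..k - 1} \<rightarrow>\<^sub>E V.
      D x = (\<Sum>i<r. \<beta> i (restrict x (S i)) * \<gamma> i (restrict x ({1..k - 1} - S i)))"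
    and kill: "\<forall>i<r. \<forall>x \<in> {1..k - 1} \<rightarrow>\<^sub>E W. card (S i) = 1 \<or> card ({1..k - 1} - S i) = 1 \<longrightarrow>
      \<beta> i (restrict x (S i)) * \<gamma> i (restrict x ({1..k - 1} - S i)) = 0"
  proof -
    have "1 \<in> {1..k - 1}"
      using k by auto
    from kill_single_variable_factors [OF V dec this] show ?thesis
      using that by blast
  qed
  have "card (S i) = 1 \<or> card ({1..k - 1} - S i) = 1" if "i < r" for i
  proof -
    have S: "S i \<subset> {1..k - 1}" "S i \<noteq> {}" and fin: "finite (S i)"
      using S that finite_subset [of "S i" "{1..k - 1}"] by auto
    have "0 < card (S i)"
      using S fin by (simp add: card_gt_0_iff)
    moreover have "card (S i) < card {1..k - 1}"
      using S(1) by (intro psubset_card_mono) auto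
    moreover have "card ({1..k - 1} - S i) = card {1..k - 1} - card (S i)"
      using S fin by (intro card_Diff_subset) auto
    ultimately show ?thesis
      using k by auto
  qed
  then have "D x = 0" if x: "x \<in> {1..k - 1} \<rightarrow>\<^sub>E W" for x
  proof -
    have "x \<in> {1..k - 1} \<rightarrow>\<^sub>E V"
      using x W(2) by (auto simp: PiE_iff)
    then have "D x = (\<Sum>i<r. \<beta> i (restrict x (S i)) * \<gamma> i (restrict x ({1..k - 1} - S i)))"
      using D by blast
    also have "\<dots> = 0"
      using kill x \<open>\<And>i. i < r \<Longrightarrow> card (S i) = 1 \<or> card ({1..k - 1} - S i) = 1\<close>
      by (intro sum.neutral ballI) (metis lessThan_iff)
    finally show ?thesis .
  qed
  then show ?thesis
    using W by blast
qed

section \<open>Numerical bounds and the conclusion\<close>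

lemma codim_bound:
  assumes "0 < r"
  shows "real (2 * r + (4 * r + 1) * (2 ^ r * (2 * r + 1))) \<le> exp (10 * real r)"
proof -
  define P :: nat where "P = 2 ^ r"
  have rP: "r \<le> P" "2 \<le> P"
    using assms power_increasing [of 1 r "2::nat"] by (auto simp: P_def less_imp_le)
  \<comment> \<open>From \<open>r \<le> P\<close> and \<open>2 \<le> P\<close> the two brackets are
    at most \<open>5 * P\<close> and \<open>3 * P\<close>. The total \<open>17 * P ^ 3\<close> is
    absorbed by \<open>P ^ 8\<close>.\<close>
  have "2 * r + (4 * r + 1) * (P * (2 * r + 1)) \<le> 2 * P + (5 * P) * (P * (3 * P))"
    using rP by (intro add_mono mult_mono) auto
  also have "\<dots> \<le> 2 * P ^ 3 + 15 * P ^ 3"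
    using rP power_increasing [of 1 3 P] by (simp add: power3_eq_cube)
  also have "\<dots> \<le> 2 ^ 5 * P ^ 3"
    by simp
  also have "\<dots> \<le> P ^ 5 * P ^ 3"
    using rP by (intro mult_le_mono1 power_mono) auto
  also have "\<dots> = 2 ^ (8 * r)"
    by (simp add: P_def power_add [symmetric] power_mult [symmetric] mult.commute)
  finally have "real (2 * r + (4 * r + 1) * (2 ^ r * (2 * r + 1))) \<le> real (2 ^ (8 * r))"
    unfolding P_def by (rule of_nat_mono)
  also have "\<dots> = 2 ^ (8 * r)"
    by simp
  also have "\<dots> \<le> exp 1 ^ (8 * r)"
    using exp_ge_add_one_self [of 1] by (intro power_mono) auto
  also have "\<dots> = exp (8 * real r)"
    by (simp add: exp_of_nat_mult [symmetric])
  also have "\<dots> \<le> exp (10 * real r)"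
    by simp
  finally show ?thesis .
qed

theorem theorem11:
  shows "\<exists>(A::real) (B::real) (t::nat). A > 0 \<and> B > 0 \<and>
    (\<forall>(k::nat) (m::nat) (r::nat) (n::nat) (\<alpha>::form).
      2 \<le> k \<and> k \<le> 5 \<and> 2 \<le> m \<and> m \<le> k \<and> 0 < r \<and>
      multilinear_form (f2_power n) {1..k} \<alpha> \<and>
      symmetric_in (f2_power n) {1..k} {1..m} \<alpha> \<and>
      prank (f2_power n) {1..k - 1} (diag12 k \<alpha>) \<le> enat r \<longrightarrow>
      (\<exists>(U::f2vec set) (\<alpha>'::form).
        f2_subspace U \<and> U \<subseteq> f2_power n \<and>
        real (f2_codim (f2_power n) U) \<le> (exp ^^ t) (A * real r) \<and>
        multilinear_form U {1..k} \<alpha>' \<and>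
        symmetric_in U {1..k} {1..m} \<alpha>' \<and>
        (\<forall>y \<in> {1..k - 1} \<rightarrow>\<^sub>E U. diag12 k \<alpha>' y = 0) \<and>
        ereal_of_enat (prank U {1..k} (\<lambda>x. \<alpha> x + \<alpha>' x)) \<le> ereal (exp (exp (A * real r powr B)))))"
\<comment> \<open>\<open>A = 10\<close> serves both bounds: \<open>corr\<close> has at most 5 choose
  2 summands of rank at most \<open>r\<close>, and the codimension is at most
  \<open>exp (8 * r)\<close>. One exponential is enough, hence \<open>t = 1\<close>; the rank bound
  is linear in \<open>r\<close>, hence \<open>B = 1\<close>.\<close>
proof (rule exI [of _ 10], rule exI [of _ 1], rule exI [of _ 1], intro conjI allI impI)
  fix k m r n :: nat and \<alpha> :: form
  assume *: "2 \<le> k \<and> k \<le> 5 \<and> 2 \<le> m \<and> m \<le> k \<and> 0 < r \<and>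
      multilinear_form (f2_power n) {1..k} \<alpha> \<and>
      symmetric_in (f2_power n) {1..k} {1..m} \<alpha> \<and>
      prank (f2_power n) {1..k - 1} (diag12 k \<alpha>) \<le> enat r"
  let ?V = "f2_power n"
  define s where "s r = 2 * r + (4 * r + 1) * (2 ^ r * (2 * r + 1))" for r :: nat
  obtain r' where r': "r' \<le> r" and dec: "has_partition_decomposition ?V {1..k - 1} (diag12 k \<alpha>) r'"
    using * prank_le_enat_iff by blast
  have "\<exists>U \<alpha>'. f2_subspace U \<and> U \<subseteq> ?V \<and> card ?V \<le> 2 ^ s r' * card U \<and>
      multilinear_form U {1..k} \<alpha>' \<and> symmetric_in U {1..k} {1..m} \<alpha>' \<and>
      (\<forall>y \<in> {1..k - 1} \<rightarrow>\<^sub>E U. diag12 k \<alpha>' y = 0) \<and>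
      prank U {1..k} (\<lambda>x. \<alpha> x + \<alpha>' x) \<le> enat (10 * r)"
  proof (cases "k = 5")
    case True
    interpret five_form ?V \<alpha> m
      using * True f2_subspace_f2_power finite_f2_power by unfold_locales auto
    have "m choose 2 \<le> 5 choose 2"
      using m by (intro binomial_right_mono) auto
    also have "(5::nat) choose 2 = 10"
      by (simp add: choose_two)
    finally have "(m choose 2) * r' \<le> 10 * r"
      using r' by (rule mult_le_mono)
    moreover have "has_partition_decomposition ?V {1..4} (diag12 5 \<alpha>) r'"
      using dec True by simp
    from ex_correction [OF this] obtain U \<alpha>' where U: "f2_subspace U" "U \<subseteq> ?V"
      "card ?V \<le> 2 ^ s r' * card U" "multilinear_form U {1..5} \<alpha>'" "symmetric_in U {1..5} {1..m} \<alpha>'"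
      "\<forall>y \<in> {1..4} \<rightarrow>\<^sub>E U. diag12 5 \<alpha>' y = 0"
      "has_partition_decomposition U {1..5} (\<lambda>x. \<alpha> x + \<alpha>' x) ((m choose 2) * r')"
      unfolding s_def by blast
    ultimately have "prank U {1..5} (\<lambda>x. \<alpha> x + \<alpha>' x) \<le> enat (10 * r)"
      using prank_le_enat_iff by blast
    then show ?thesis
      using U(1-6) True by (intro exI [of _ U] exI [of _ \<alpha>']) simp
  next
    case False
    then obtain W where W: "f2_subspace W" "W \<subseteq> ?V" "card ?V \<le> 2 ^ r' * card W"
      "\<forall>x \<in> {1..k - 1} \<rightarrow>\<^sub>E W. diag12 k \<alpha> x = 0"
      using ex_zero_subspace_small_arity [OF f2_subspace_f2_power finite_f2_power _ _ dec] * by auto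
    have "(2::nat) ^ r' \<le> 2 ^ s r'"
      by (intro power_increasing) (auto simp: s_def)
    then have "card ?V \<le> 2 ^ s r' * card W"
      using W(3) by (meson mult_le_mono1 order_trans)
    \<comment> \<open>On \<open>W\<close> the choice \<open>\<alpha>' = \<alpha>\<close> works, and
      the sum of the two forms is zero.\<close>
    moreover have "has_partition_decomposition W {1..k} (\<lambda>x. \<alpha> x + \<alpha> x) 0"
      by (simp add: has_partition_decomposition_0)
    then have "prank W {1..k} (\<lambda>x. \<alpha> x + \<alpha> x) \<le> enat (10 * r)"
      using prank_le_enat_iff by blast
    moreover have "multilinear_form W {1..k} \<alpha>" "symmetric_in W {1..k} {1..m} \<alpha>"
      using * W(2) multilinear_form_mono symmetric_in_mono by blast+
    ultimately show ?thesis
      using W by blast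
  qed
  then obtain U \<alpha>' where U: "f2_subspace U" "U \<subseteq> ?V" "card ?V \<le> 2 ^ s r' * card U"
      "multilinear_form U {1..k} \<alpha>'" "symmetric_in U {1..k} {1..m} \<alpha>'"
      "\<forall>y \<in> {1..k - 1} \<rightarrow>\<^sub>E U. diag12 k \<alpha>' y = 0"
      "prank U {1..k} (\<lambda>x. \<alpha> x + \<alpha>' x) \<le> enat (10 * r)"
    by blast
  have "s r' \<le> s r"
    using r' unfolding s_def by (intro add_mono mult_mono power_increasing) auto
  then have "real (f2_codim ?V U) \<le> real (s r)"
    using f2_codim_le_of_card [OF f2_subspace_f2_power U(1) finite_f2_power U(2,3)] by simp
  also have "\<dots> \<le> exp (10 * real r)"
    unfolding s_def using * by (intro codim_bound) auto
  finally have codim: "real (f2_codim ?V U) \<le> (exp ^^ 1) (10 * real r)"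
    by simp
  have "ereal_of_enat (prank U {1..k} (\<lambda>x. \<alpha> x + \<alpha>' x)) \<le> ereal_of_enat (enat (10 * r))"
    using U(7) by (simp only: ereal_of_enat_le_iff)
  also have "\<dots> \<le> ereal (exp (exp (10 * real r powr 1)))"
  proof -
    have "10 * real r \<le> exp (exp (10 * real r))"
      using exp_ge_add_one_self [of "10 * real r"] exp_ge_add_one_self [of "exp (10 * real r)"]
      by linarith
    then show ?thesis
      by simp
  qed
  finally show "\<exists>U \<alpha>'. f2_subspace U \<and> U \<subseteq> ?V \<and>
        real (f2_codim ?V U) \<le> (exp ^^ 1) (10 * real r) \<and>
        multilinear_form U {1..k} \<alpha>' \<and>
        symmetric_in U {1..k} {1..m} \<alpha>' \<and>
        (\<forall>y \<in> {1..k - 1} \<rightarrow>\<^sub>E U. diag12 k \<alpha>' y = 0) \<and>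
        ereal_of_enat (prank U {1..k} (\<lambda>x. \<alpha> x + \<alpha>' x)) \<le> ereal (exp (exp (10 * real r powr 1)))"
    using U codim by blast
qed simp_all

end
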